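(* Let $h\in L^0(M,N)$ and $p\in(1,\infty)$. Suppose that $\mu_M$ is not purely infinite and that $N$ is complete and separable. Then the following assertions are equivalent: (i) $L^p_h(M,N)$ is a length (resp. geodesic) space; (ii) $N$ is a length (resp. geodesic) space.
   Context: Setting: $(M,\Sigma_M,\mu_M)$ is a measure space with $M$ nonempty, $(N,d_N)$ is a nonempty metric space with finite metric, and $I=[a,b]\subset\mathbb{R}$ with $a<b$. $\mu_M$ is purely infinite if $\mu_M(A)\in\{0,\infty\}$ for every measurable set $A$. $L^0(M,N)$ is the set of $\mu_M$-a.e.-equality classes of measurable maps $M\to N$ (Borel $\sigma$-algebra on $N$) with separable range. For $h\in L^0(M,N)$ and $p\in[1,\infty)$, $L^p_h(M,N)$ is the set of $f\in L^0(M,N)$ with $D_p(f,h)<\infty$, with the metric $D_p(f,f')=(\int_M d_N(f(x),f'(x))^p\,d\mu_M(x))^{1/p}$. For a metric space $(X,d_X)$, $\mathcal{AC}(I,X)$ is the set of absolutely continuous curves, i.e. $c:I\to X$ for which there is $m\in L^1(I)$ with $d_X(c(s),c(t))\le\int_s^t m(r)\,dr$ for all $s\le t$ in $I$. The metric derivative $|c'|_X(t)=\lim_{s\to t}d_X(c(s),c(t))/|s-t|$ exists for a.e. $t$; the length of $c$ is $L_X(c)=\int_I|c'|_X(t)\,dt$. The intrinsic metric is $\widehat d_X(x,x')=\inf\{L_X(c):c\in\mathcal{AC}(I,X),c(a)=x,c(b)=x'\}\in[0,\infty]$. $X$ is a length space if $d_X=\widehat d_X$, and a geodesic space if for all $x,x'\in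 X$ there is $c\in\mathcal{AC}(I,X)$ connecting $x$ to $x'$ with $L_X(c)=d_X(x,x')$. *)

theory Defs
  imports "HOL-Analysis.Analysis"
begin

section \<open>Curves in metric spaces, length and geodesic spaces\<close>

text \<open>
  As in the library locale \<^locale>\<open>Metric_space\<close>, a metric space is given by a carrier \<open>X\<close> and
  a distance function \<open>d\<close>. The interval \<open>I = [a, b]\<close> is kept as a pair of parameters.
  Values of a curve outside \<open>I\<close> play no role.
\<close>

definition ac_curves :: "real \<Rightarrow> real \<Rightarrow> 'x set \<Rightarrow> ('x \<Rightarrow> 'x \<Rightarrow> real) \<Rightarrow> (real \<Rightarrow> 'x) set" where
  "ac_curves a b X d = {c. c \<in> {a..b} \<rightarrow> X \<and>
     (\<exists>m :: real \<Rightarrow> real. set_integrable lebesgue {a..b} m \<and>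
        (\<forall>s t. a \<le> s \<and> s \<le> t \<and> t \<le> b \<longrightarrow> d (c s) (c t) \<le> (LINT r:{s..t}|lebesgue. m r)))}"

text \<open>Only \<open>s \<in> I\<close> is considered in the limit. The value is unspecified where there is no limit;
  for absolutely continuous curves this is a null set.\<close>

definition metric_deriv ::
  "real \<Rightarrow> real \<Rightarrow> ('x \<Rightarrow> 'x \<Rightarrow> real) \<Rightarrow> (real \<Rightarrow> 'x) \<Rightarrow> real \<Rightarrow> real" where
  "metric_deriv a b d c t = Lim (at t within {a..b}) (\<lambda>s. d (c s) (c t) / \<bar>s - t\<bar>)"

definition curve_length ::
  "real \<Rightarrow> real \<Rightarrow> ('x \<Rightarrow> 'x \<Rightarrow> real) \<Rightarrow> (real \<Rightarrow> 'x) \<Rightarrow> ennreal" where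
  "curve_length a b d c = (\<integral>\<^sup>+ t\<in>{a..b}. ennreal (metric_deriv a b d c t) \<partial>lebesgue)"

text \<open>The infimum over the empty set is \<open>\<infinity>\<close> in \<^typ>\<open>ennreal\<close>.\<close>

definition intrinsic_dist ::
  "real \<Rightarrow> real \<Rightarrow> 'x set \<Rightarrow> ('x \<Rightarrow> 'x \<Rightarrow> real) \<Rightarrow> 'x \<Rightarrow> 'x \<Rightarrow> ennreal" where
  "intrinsic_dist a b X d x y =
     Inf {curve_length a b d c | c. c \<in> ac_curves a b X d \<and> c a = x \<and> c b = y}"

definition length_space :: "real \<Rightarrow> real \<Rightarrow> 'x set \<Rightarrow> ('x \<Rightarrow> 'x \<Rightarrow> real) \<Rightarrow> bool" where
  "length_space a b X d \<longleftrightarrow> (\<forall>x\<in>X. \<forall>y\<in>X. ennreal (d x y) = intrinsic_dist a b X d x y)"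

definition geodesic_space :: "real \<Rightarrow> real \<Rightarrow> 'x set \<Rightarrow> ('x \<Rightarrow> 'x \<Rightarrow> real) \<Rightarrow> bool" where
  "geodesic_space a b X d \<longleftrightarrow> (\<forall>x\<in>X. \<forall>y\<in>X. \<exists>c\<in>ac_curves a b X d.
     c a = x \<and> c b = y \<and> curve_length a b d c = ennreal (d x y))"


section \<open>Measure spaces and spaces of metric-valued maps\<close>

definition purely_infinite :: "'m measure \<Rightarrow> bool" where
  "purely_infinite M \<longleftrightarrow> (\<forall>A\<in>sets M. emeasure M A = 0 \<or> emeasure M A = \<infinity>)"

definition sep_maps :: "'m measure \<Rightarrow> ('m \<Rightarrow> 'n::metric_space) set" where
  "sep_maps M = {f \<in> borel_measurable M. separable_space (top_of_set (f ` space M))}"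

definition ae_rel :: "'m measure \<Rightarrow> (('m \<Rightarrow> 'n::metric_space) \<times> ('m \<Rightarrow> 'n)) set" where
  "ae_rel M = {(f, g). f \<in> sep_maps M \<and> g \<in> sep_maps M \<and> (AE x in M. f x = g x)}"

definition L0 :: "'m measure \<Rightarrow> ('m \<Rightarrow> 'n::metric_space) set set" where
  "L0 M = sep_maps M // ae_rel M"

text \<open>Real powers of extended nonnegative reals, for exponents \<open>q > 0\<close>.\<close>

definition ennreal_powr :: "ennreal \<Rightarrow> real \<Rightarrow> ennreal" where
  "ennreal_powr x q = (if x = \<infinity> then \<infinity> else ennreal (enn2real x powr q))"

definition Dp_fun :: "'m measure \<Rightarrow> real \<Rightarrow> ('m \<Rightarrow> 'n::metric_space) \<Rightarrow> ('m \<Rightarrow> 'n) \<Rightarrow> ennreal" where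
  "Dp_fun M p f g = ennreal_powr (\<integral>\<^sup>+ x. ennreal (dist (f x) (g x) powr p) \<partial>M) (1 / p)"

text \<open>On classes, via representatives; see \<open>Dp_eq\<close> below for independence of the choice.\<close>

definition Dp :: "'m measure \<Rightarrow> real \<Rightarrow> ('m \<Rightarrow> 'n::metric_space) set \<Rightarrow> ('m \<Rightarrow> 'n) set \<Rightarrow> ennreal" where
  "Dp M p F G = Dp_fun M p (SOME f. f \<in> F) (SOME g. g \<in> G)"

definition Lp :: "'m measure \<Rightarrow> real \<Rightarrow> ('m \<Rightarrow> 'n::metric_space) set \<Rightarrow> ('m \<Rightarrow> 'n) set set" where
  "Lp M p h = {F \<in> L0 M. Dp M p F h < \<infinity>}"

text \<open>\<open>Dp\<close> is finite on \<open>Lp M p h\<close> (lemma \<open>Dp_finite\<close> below), so nothing is lost in passing to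
  a real-valued distance there.\<close>

definition Lp_dist :: "'m measure \<Rightarrow> real \<Rightarrow> ('m \<Rightarrow> 'n::metric_space) set \<Rightarrow> ('m \<Rightarrow> 'n) set \<Rightarrow> real" where
  "Lp_dist M p F G = enn2real (Dp M p F G)"


section \<open>Well-definedness\<close>

lemma equiv_ae_rel:
  fixes M :: "'m measure"
  shows "equiv (sep_maps M :: ('m \<Rightarrow> 'n::metric_space) set) (ae_rel M)"
proof (rule equivI)
  show "(ae_rel M :: (('m \<Rightarrow> 'n) \<times> ('m \<Rightarrow> 'n)) set) \<subseteq> sep_maps M \<times> sep_maps M" by (auto simp: ae_rel_def)
  show "refl_on (sep_maps M :: ('m \<Rightarrow> 'n) set) (ae_rel M)" by (auto simp: refl_on_def ae_rel_def)
  show "sym (ae_rel M :: (('m \<Rightarrow> 'n) \<times> ('m \<Rightarrow> 'n)) set)" by (auto simp: sym_def ae_rel_def eq_commute)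
  show "trans (ae_rel M :: (('m \<Rightarrow> 'n) \<times> ('m \<Rightarrow> 'n)) set)"
  proof (rule transI)
    fix f g k :: "'m \<Rightarrow> 'n"
    assume *: "(f, g) \<in> ae_rel M" "(g, k) \<in> ae_rel M"
    then have "AE x in M. f x = g x" "AE x in M. g x = k x" by (auto simp: ae_rel_def)
    then have "AE x in M. f x = k x" by eventually_elim simp
    with * show "(f, k) \<in> ae_rel M" by (auto simp: ae_rel_def)
  qed
qed

lemma L0_rep:
  assumes "F \<in> L0 M"
  shows "(SOME f. f \<in> F) \<in> F"
proof -
  have "F \<noteq> {}" using assms in_quotient_imp_non_empty[OF equiv_ae_rel] by (auto simp: L0_def)
  then show ?thesis by (simp add: some_in_eq)
qed

lemma L0_measurable: "F \<in> L0 M \<Longrightarrow> f \<in> F \<Longrightarrow> f \<in> borel_measurable M"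
  using in_quotient_imp_subset[OF equiv_ae_rel] by (fastforce simp: L0_def sep_maps_def)

lemma L0_AE: "F \<in> L0 M \<Longrightarrow> f \<in> F \<Longrightarrow> g \<in> F \<Longrightarrow> AE x in M. f x = g x"
  using quotient_eq_iff[OF equiv_ae_rel, of F M F f g] by (auto simp: L0_def ae_rel_def)

lemma L0_eqI:
  assumes "F \<in> L0 M" "G \<in> L0 M" "f \<in> F" "g \<in> G" "AE x in M. f x = g x"
  shows "F = G"
proof -
  have "f \<in> sep_maps M" "g \<in> sep_maps M"
    using assms in_quotient_imp_subset[OF equiv_ae_rel] by (fastforce simp: L0_def)+
  with assms show ?thesis
    using quotient_eq_iff[OF equiv_ae_rel, of F M G f g] by (auto simp: L0_def ae_rel_def)
qed

lemma Dp_eq: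
  assumes "F \<in> L0 M" "G \<in> L0 M" "f \<in> F" "g \<in> G"
  shows "Dp M p F G = Dp_fun M p f g"
proof -
  have "AE x in M. (SOME f. f \<in> F) x = f x" "AE x in M. (SOME g. g \<in> G) x = g x"
    using assms L0_AE L0_rep by blast+
  then have "AE x in M. ennreal (dist ((SOME f. f \<in> F) x) ((SOME g. g \<in> G) x) powr p)
      = ennreal (dist (f x) (g x) powr p)"
    by eventually_elim simp
  then show ?thesis unfolding Dp_def Dp_fun_def by (simp only: nn_integral_cong_AE)
qed

lemma ennreal_powr_le_iff:
  assumes "p > 0" "A \<ge> 0"
  shows "ennreal_powr x (1 / p) \<le> ennreal A \<longleftrightarrow> x \<le> ennreal (A powr p)"
proof (cases x)
  case (real r)
  have "r powr (1 / p) \<le> A \<longleftrightarrow> r \<le> A powr p"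
  proof
    assume "r powr (1 / p) \<le> A"
    then have "(r powr (1 / p)) powr p \<le> A powr p" using assms by (intro powr_mono2) auto
    then show "r \<le> A powr p" using assms real by (simp add: powr_powr)
  next
    assume "r \<le> A powr p"
    then have "r powr (1 / p) \<le> (A powr p) powr (1 / p)" using assms real by (intro powr_mono2) auto
    then show "r powr (1 / p) \<le> A" using assms by (simp add: powr_powr)
  qed
  with real assms show ?thesis by (simp add: ennreal_powr_def)
next
  case top
  then show ?thesis by (simp add: ennreal_powr_def top_unique)
qed

lemma powr_convex_aux:
  fixes x y t p :: real
  assumes "p \<ge> 1" "x \<ge> 0" "y \<ge> 0" "0 < t" "t < 1"
  shows "(t * x + (1 - t) * y) powr p \<le> t * x powr p + (1 - t) * y powr p"
proof -
  have le: "s powr p \<le> s" if "0 < s" "s < 1" for s :: real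
    using powr_mono'[of 1 p s] that assms by simp
  consider "x = 0" | "y = 0" | "x > 0" "y > 0" using assms by force
  then show ?thesis
  proof cases
    case 1
    with le[of "1 - t"] assms show ?thesis by (simp add: powr_mult mult_right_mono)
  next
    case 2
    with le[of t] assms show ?thesis by (simp add: powr_mult mult_right_mono)
  next
    case 3
    then show ?thesis
      using convex_onD[OF powr_convex[OF assms(1)], of "1 - t" x y] assms by simp
  qed
qed

lemma Minkowski_aux:
  fixes u v :: "'m \<Rightarrow> real"
  assumes [measurable]: "u \<in> borel_measurable M" "v \<in> borel_measurable M"
    and nn: "\<And>x. u x \<ge> 0" "\<And>x. v x \<ge> 0" and p: "p \<ge> 1" and AB: "A > 0" "B > 0"
    and uA: "(\<integral>\<^sup>+ x. ennreal (u x powr p) \<partial>M) \<le> ennreal (A powr p)"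
    and vB: "(\<integral>\<^sup>+ x. ennreal (v x powr p) \<partial>M) \<le> ennreal (B powr p)"
  shows "(\<integral>\<^sup>+ x. ennreal ((u x + v x) powr p) \<partial>M) \<le> ennreal ((A + B) powr p)"
proof -
  define t where "t = A / (A + B)"
  define C where "C = (A + B) powr p"
  have t: "0 < t" "t < 1" and t': "1 - t = B / (A + B)"
    using AB by (auto simp: t_def field_simps)
  define \<alpha> where "\<alpha> = C * t / A powr p"
  define \<beta> where "\<beta> = C * (1 - t) / B powr p"
  have nonneg: "\<alpha> \<ge> 0" "\<beta> \<ge> 0" "C \<ge> 0" using t by (auto simp: \<alpha>_def \<beta>_def C_def)
  have pt: "(u x + v x) powr p \<le> \<alpha> * u x powr p + \<beta> * v x powr p" for x
  proof -
    have "t * (u x / A) + (1 - t) * (v x / B) = (u x + v x) / (A + B)"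
      unfolding t' using AB by (simp add: t_def add_divide_distrib)
    then have "((u x + v x) / (A + B)) powr p
        \<le> t * (u x / A) powr p + (1 - t) * (v x / B) powr p"
      using powr_convex_aux[OF p, of "u x / A" "v x / B" t] nn AB t by simp
    then have "(u x + v x) powr p / C \<le> t * (u x powr p / A powr p) + (1 - t) * (v x powr p / B powr p)"
      using nn AB by (simp add: powr_divide C_def)
    moreover have "C > 0" using AB by (simp add: C_def)
    ultimately show ?thesis by (simp add: \<alpha>_def \<beta>_def pos_divide_le_eq algebra_simps)
  qed
  have "(\<integral>\<^sup>+ x. ennreal ((u x + v x) powr p) \<partial>M)
      \<le> (\<integral>\<^sup>+ x. ennreal \<alpha> * ennreal (u x powr p) + ennreal \<beta> * ennreal (v x powr p) \<partial>M)"
    using pt nonneg by (intro nn_integral_mono) (simp flip: ennreal_mult ennreal_plus)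
  also have "\<dots> = ennreal \<alpha> * (\<integral>\<^sup>+ x. ennreal (u x powr p) \<partial>M)
      + ennreal \<beta> * (\<integral>\<^sup>+ x. ennreal (v x powr p) \<partial>M)"
    by (simp add: nn_integral_add nn_integral_cmult)
  also have "\<dots> \<le> ennreal \<alpha> * ennreal (A powr p) + ennreal \<beta> * ennreal (B powr p)"
    using uA vB by (intro add_mono mult_left_mono) auto
  also have "\<dots> = ennreal (\<alpha> * A powr p + \<beta> * B powr p)"
    using nonneg by (simp flip: ennreal_mult ennreal_plus)
  also have "\<alpha> * A powr p + \<beta> * B powr p = C"
  proof -
    have "\<alpha> * A powr p = C * t" "\<beta> * B powr p = C * (1 - t)"
      using AB by (simp_all add: \<alpha>_def \<beta>_def)
    then show ?thesis by (simp add: algebra_simps)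
  qed
  finally show ?thesis by (simp add: C_def)
qed

lemma Dp_fun_triangle:
  fixes f g k :: "'m \<Rightarrow> 'n::{metric_space, second_countable_topology}"
  assumes [measurable]: "f \<in> borel_measurable M" "g \<in> borel_measurable M" "k \<in> borel_measurable M"
    and p: "p \<ge> 1"
  shows "Dp_fun M p f k \<le> Dp_fun M p f g + Dp_fun M p g k"
proof (rule ennreal_le_epsilon)
  fix e :: real
  assume fin: "Dp_fun M p f g + Dp_fun M p g k < top" and e: "0 < e"
  define A where "A = enn2real (Dp_fun M p f g) + e / 2"
  define B where "B = enn2real (Dp_fun M p g k) + e / 2"
  have AB: "A > 0" "B > 0" using e by (auto simp: A_def B_def add_nonneg_pos)
  have eqs: "ennreal A = Dp_fun M p f g + ennreal (e / 2)" "ennreal B = Dp_fun M p g k + ennreal (e / 2)"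
    using fin e by (auto simp: A_def B_def ennreal_plus)
  have 1: "Dp_fun M p f g \<le> ennreal A" "Dp_fun M p g k \<le> ennreal B"
    unfolding eqs by auto
  have "(\<integral>\<^sup>+ x. ennreal (dist (f x) (k x) powr p) \<partial>M)
      \<le> (\<integral>\<^sup>+ x. ennreal ((dist (f x) (g x) + dist (g x) (k x)) powr p) \<partial>M)"
    using p by (intro nn_integral_mono ennreal_leI powr_mono2 dist_triangle) auto
  also have "\<dots> \<le> ennreal ((A + B) powr p)"
    using 1 AB p unfolding Dp_fun_def
    by (intro Minkowski_aux) (simp_all add: ennreal_powr_le_iff)
  finally have "Dp_fun M p f k \<le> ennreal (A + B)"
    using AB p ennreal_powr_le_iff[of p "A + B"] unfolding Dp_fun_def by simp
  also have "\<dots> = Dp_fun M p f g + Dp_fun M p g k + ennreal e"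
  proof -
    have "ennreal (A + B) = ennreal A + ennreal B" using AB by (simp add: ennreal_plus)
    also have "\<dots> = Dp_fun M p f g + Dp_fun M p g k + (ennreal (e / 2) + ennreal (e / 2))"
      by (simp add: eqs ac_simps)
    also have "ennreal (e / 2) + ennreal (e / 2) = ennreal e" using e by (simp flip: ennreal_plus)
    finally show ?thesis .
  qed
  finally show "Dp_fun M p f k \<le> Dp_fun M p f g + Dp_fun M p g k + ennreal e" .
qed

lemma Dp_commute: "Dp M p F G = Dp M p G F"
  by (simp add: Dp_def Dp_fun_def dist_commute)

lemma Dp_triangle:
  fixes F G K :: "('m \<Rightarrow> 'n::{metric_space, second_countable_topology}) set"
  assumes "F \<in> L0 M" "G \<in> L0 M" "K \<in> L0 M" "p \<ge> 1"
  shows "Dp M p F K \<le> Dp M p F G + Dp M p G K"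
  unfolding Dp_def by (intro Dp_fun_triangle) (use assms L0_rep L0_measurable in blast)+

lemma Dp_eq_0_iff:
  fixes F G :: "('m \<Rightarrow> 'n::{metric_space, second_countable_topology}) set"
  assumes "F \<in> L0 M" "G \<in> L0 M" "p \<ge> 1"
  shows "Dp M p F G = 0 \<longleftrightarrow> F = G"
proof -
  let ?f = "SOME f. f \<in> F" and ?g = "SOME g. g \<in> G"
  have [measurable]: "?f \<in> borel_measurable M" "?g \<in> borel_measurable M"
    using assms L0_rep L0_measurable by blast+
  have "Dp M p F G = 0 \<longleftrightarrow> (\<integral>\<^sup>+ x. ennreal (dist (?f x) (?g x) powr p) \<partial>M) = 0"
    using assms ennreal_powr_le_iff[of p 0] by (simp add: Dp_def Dp_fun_def)
  also have "\<dots> \<longleftrightarrow> (AE x in M. ?f x = ?g x)"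
    by (subst nn_integral_0_iff_AE) (auto simp: powr_def)
  also have "\<dots> \<longleftrightarrow> F = G"
    using L0_eqI[OF assms(1,2) L0_rep L0_rep] assms by auto
  finally show ?thesis .
qed

lemma Dp_finite:
  fixes F G h :: "('m \<Rightarrow> 'n::{metric_space, second_countable_topology}) set"
  assumes "h \<in> L0 M" "p \<ge> 1" "F \<in> Lp M p h" "G \<in> Lp M p h"
  shows "Dp M p F G < \<infinity>"
proof -
  have "Dp M p F G \<le> Dp M p F h + Dp M p h G"
    using assms by (intro Dp_triangle) (auto simp: Lp_def)
  also have "\<dots> < \<infinity>" using assms by (simp add: Lp_def Dp_commute[of M p h])
  finally show ?thesis .
qed

lemma Metric_space_Lp:
  fixes h :: "('m \<Rightarrow> 'n::{metric_space, second_countable_topology}) set"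
  assumes h: "h \<in> L0 M" and p: "p \<ge> 1"
  shows "Metric_space (Lp M p h) (Lp_dist M p)"
proof
  fix F G K :: "('m \<Rightarrow> 'n) set"
  show "0 \<le> Lp_dist M p F G" by (simp add: Lp_dist_def)
  show "Lp_dist M p F G = Lp_dist M p G F" by (simp add: Lp_dist_def Dp_commute)
  assume F: "F \<in> Lp M p h" and G: "G \<in> Lp M p h"
  have "Dp M p F G < \<infinity>" using Dp_finite[OF h p F G] .
  then show "Lp_dist M p F G = 0 \<longleftrightarrow> F = G"
    using Dp_eq_0_iff[of F M G p] F G p by (auto simp: Lp_dist_def Lp_def enn2real_eq_0_iff)
  assume K: "K \<in> Lp M p h"
  have fin: "Dp M p F G < \<infinity>" "Dp M p G K < \<infinity>" using Dp_finite[OF h p] F G K by auto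
  have "Lp_dist M p F K \<le> enn2real (Dp M p F G + Dp M p G K)"
    unfolding Lp_dist_def using fin F G K p
    by (intro enn2real_mono Dp_triangle) (auto simp: Lp_def)
  also have "\<dots> = Lp_dist M p F G + Lp_dist M p G K"
    using fin by (simp add: Lp_dist_def enn2real_plus)
  finally show "Lp_dist M p F K \<le> Lp_dist M p F G + Lp_dist M p G K" .
qed

end

theory Submission
  imports Defs
begin

text \<open>
  Both equivalences are read off from midpoints. Call \<open>z\<close> a \<open>\<kappa>\<close>-midpoint of \<open>x\<close> and \<open>y\<close> if both
  distances from \<open>z\<close> are at most \<open>\<kappa> / 2\<close> times the distance of \<open>x\<close> and \<open>y\<close>. A length space has
  \<open>\<kappa>\<close>-midpoints for every \<open>\<kappa> > 1\<close> and a geodesic space has \<open>1\<close>-midpoints: cut a connecting curve at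
  the point where half of its length is used up. In the other direction, midpoints inserted at all
  dyadic times give a Lipschitz path, provided that limits exist. So it suffices to move midpoints
  between \<open>N\<close> and \<open>L\<^sup>p\<close>.

  From \<open>N\<close> to \<open>L\<^sup>p\<close>: for maps \<open>f\<close> and \<open>g\<close> at finite distance choose a midpoint of \<open>f x\<close> and \<open>g x\<close>
  for almost every \<open>x\<close>, measurably in \<open>x\<close>. The set of midpoints of two points is closed but in general
  not compact, which makes the selection the delicate point: a capacity argument finds compact sets that
  contain midpoints of \<open>f x\<close> and \<open>g x\<close> for all but a small set of \<open>x\<close>, and within a compact set a
  selection can be written down (\<open>measurable_selection_AE\<close>). The dyadic construction is then carried
  out pointwise in \<open>N\<close>, and the family of maps that it yields is Lipschitz in \<open>L\<^sup>p\<close>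
  (\<open>Lp_has_Lipschitz_paths\<close>).

  From \<open>L\<^sup>p\<close> to \<open>N\<close>: given \<open>y\<close> and \<open>z\<close>, take a set \<open>B\<close> of positive finite measure and maps that agree
  off \<open>B\<close> and are constantly \<open>y\<close>, respectively \<open>z\<close>, on \<open>B\<close>. Let \<open>k\<close> be a midpoint of them in \<open>L\<^sup>p\<close>. On
  \<open>B\<close> the average of \<open>u\<^sup>p + v\<^sup>p\<close>, where \<open>u = d(y, k x)\<close> and \<open>v = d(k x, z)\<close>, is nearly the least value
  that \<open>u + v \<ge> d(y, z)\<close> permits. Strict convexity of the \<open>p\<close>-th power, which is where \<open>p > 1\<close> is
  used, makes \<open>k x\<close> a midpoint for some \<open>x\<close>
  (\<open>midpoints_from_Lp_approximate\<close>, \<open>midpoints_from_Lp_exact\<close>).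

  Underneath lies the metric derivative of an absolutely continuous curve: it exists almost
  everywhere and its integral bounds distances along the curve (\<open>ac_curve_metric_derivative\<close>). This
  rests on Lebesgue's differentiation theorem on the line and on the Radon--Nikodym theorem.
\<close>

section \<open>Lebesgue's differentiation theorem on the line\<close>

lemma set_integral_atMost_diff:
  fixes f :: "real \<Rightarrow> real"
  assumes f: "integrable lborel f" and st: "s \<le> t"
  shows "(LINT x:{..t}|lborel. f x) - (LINT x:{..s}|lborel. f x) = (LINT x:{s..t}|lborel. f x)"
proof -
  have i: "set_integrable lborel A f" if "A \<in> sets borel" for A
    using f that unfolding set_integrable_def by (intro integrable_mult_indicator) auto
  have "{..t} = {..s} \<union> {s<..t}" using st by auto
  moreover have "(LINT x:{..s} \<union> {s<..t}|lborel. f x)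
      = (LINT x:{..s}|lborel. f x) + (LINT x:{s<..t}|lborel. f x)"
    by (intro set_integral_Un i) auto
  moreover have "(LINT x:{s<..t}|lborel. f x) = (LINT x:{s..t}|lborel. f x)"
  proof -
    have "AE x in lborel. (x \<in> {s<..t}) = (x \<in> {s..t})"
      using AE_lborel_singleton[of s] by eventually_elim auto
    then show ?thesis using f by (intro set_integral_cong_set) (auto simp: set_borel_measurable_def)
  qed
  ultimately show ?thesis by simp
qed

lemma set_integral_atMost_continuous:
  fixes f :: "real \<Rightarrow> real"
  assumes f: "integrable lborel f"
  shows "continuous_on S (\<lambda>t. LINT x:{..t}|lborel. f x)"
proof -
  have [measurable]: "f \<in> borel_measurable borel" using f by auto
  have "isCont (\<lambda>t. LINT x:{..t}|lborel. f x) t" for t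
  proof (rule continuous_at_sequentiallyI)
    fix u :: "nat \<Rightarrow> real" assume u: "u \<longlonglongrightarrow> t"
    show "(\<lambda>n. LINT x:{..u n}|lborel. f x) \<longlonglongrightarrow> (LINT x:{..t}|lborel. f x)"
      unfolding set_lebesgue_integral_def
    proof (rule integral_dominated_convergence[where w = "\<lambda>x. \<bar>f x\<bar>"])
      show "AE x in lborel. (\<lambda>n. indicat_real {..u n} x *\<^sub>R f x) \<longlonglongrightarrow> indicat_real {..t} x *\<^sub>R f x"
        using AE_lborel_singleton[of t]
      proof eventually_elim
        case (elim x)
        have "eventually (\<lambda>n. indicat_real {..u n} x *\<^sub>R f x = indicat_real {..t} x *\<^sub>R f x) sequentially"
        proof (cases "x < t")
          case True
          from order_tendstoD(1)[OF u this] show ?thesis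
            by eventually_elim (use True in \<open>auto simp: indicator_def\<close>)
        next
          case False
          with elim have "t < x" by auto
          from order_tendstoD(2)[OF u this] show ?thesis
            by eventually_elim (use \<open>t < x\<close> in \<open>auto simp: indicator_def\<close>)
        qed
        then show ?case by (rule tendsto_eventually)
      qed
    qed (use f in \<open>auto simp: indicator_def\<close>)
  qed
  then show ?thesis by (simp add: continuous_at_imp_continuous_on)
qed

text \<open>
  The positive part of \<open>f - \<beta>\<close> vanishes on \<open>E\<close>, so its integral over a suitable open set around \<open>E\<close>
  is tiny. Intervals with mean value of \<open>f\<close> above \<open>\<beta>\<close> form a Vitali cover of \<open>E\<close> within that open
  set, and on each of them the negative part of \<open>f - \<beta>\<close> weighs no more than the positive part. Hence
  the negative part, which is strictly positive on \<open>E\<close>, has integral zero over \<open>E\<close>. Only rational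
  points \<open>q\<close> are compared with \<open>t\<close> so that \<open>E\<close> is visibly a Borel set.
\<close>

lemma null_set_upper_derivative_gt:
  fixes f :: "real \<Rightarrow> real" and a b \<beta> :: real
  assumes f: "integrable lborel f"
  defines "F \<equiv> \<lambda>t. LINT x:{..t}|lborel. f x"
  defines "E \<equiv> {t. a < t \<and> t < b \<and> f t < \<beta> \<and>
    (\<forall>n::nat. \<exists>q\<in>\<rat>. q \<noteq> t \<and> \<bar>q - t\<bar> < 1 / (real n + 1) \<and> \<beta> < (F q - F t) / (q - t))}"
  shows "E \<in> null_sets lborel"
proof -
  have [measurable]: "f \<in> borel_measurable borel" using f by auto
  have [measurable]: "F \<in> borel_measurable borel"
    unfolding F_def by (intro borel_measurable_continuous_onI set_integral_atMost_continuous f)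
  have [simp]: "countable (\<rat> :: real set)" by (rule countable_rat)
  have E[measurable]: "E \<in> sets borel" unfolding E_def by measurable
  \<comment> \<open>the cutoff to a bounded interval makes \<open>f - \<beta>\<close> integrable\<close>
  define h where "h = (\<lambda>x. indicator {a<..<b} x * (f x - \<beta>))"
  have [measurable]: "h \<in> borel_measurable borel" by (simp add: h_def)
  have h: "integrable lborel h"
  proof -
    have "emeasure lborel {a<..<b} < top" by (cases "a \<le> b") auto
    then have "integrable lborel (\<lambda>x. indicator {a<..<b} x *\<^sub>R f x - indicator {a<..<b} x *\<^sub>R \<beta>)"
      using f by (intro Bochner_Integration.integrable_diff integrable_mult_indicator[of _ _ f])
        (auto simp: integrable_indicator_iff intro!: integrable_mult_left)
    then show ?thesis by (simp add: h_def right_diff_distrib)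
  qed
  define P where "P = density lborel (\<lambda>x. ennreal (h x))"
  define N where "N = density lborel (\<lambda>x. ennreal (- h x))"
  have [simp, measurable_cong]: "sets P = sets borel" "sets N = sets borel"
    by (simp_all add: P_def N_def)
  have eP: "emeasure P A = (\<integral>\<^sup>+x. ennreal (h x) * indicator A x \<partial>lborel)"
    and eN: "emeasure N A = (\<integral>\<^sup>+x. ennreal (- h x) * indicator A x \<partial>lborel)"
    if "A \<in> sets borel" for A
    using that by (simp_all add: P_def N_def emeasure_density)
  have P_fin: "emeasure P (space P) \<noteq> \<infinity>"
  proof -
    have "emeasure P UNIV \<le> (\<integral>\<^sup>+x. norm (h x) \<partial>lborel)"
      by (subst eP) (auto intro!: nn_integral_mono ennreal_leI)
    also have "\<dots> < \<infinity>" using h by (simp add: integrable_iff_bounded)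
    finally show ?thesis by (simp add: P_def)
  qed
  have PE: "emeasure P E = 0"
  proof -
    have z: "ennreal (h x) * (indicator E x :: ennreal) = 0" for x
      by (auto simp: h_def E_def indicator_def ennreal_neg)
    have "(\<integral>\<^sup>+x. ennreal (h x) * indicator E x \<partial>lborel) = (\<integral>\<^sup>+(x::real). 0 \<partial>lborel)"
      by (intro nn_integral_cong z)
    then show ?thesis by (simp only: eP[OF E] nn_integral_const mult_zero_left)
  qed
  have N_le_P: "emeasure N {s..t} \<le> emeasure P {s..t}"
    if st: "s < t" "a < s" "t < b" and gt: "\<beta> * (t - s) \<le> (LINT x:{s..t}|lborel. f x)" for s t
  proof -
    define k where "k = (\<lambda>x. indicator {s..t} x * h x)"
    have k: "integrable lborel k" using integrable_mult_indicator[OF _ h, of "{s..t}"] by (simp add: k_def)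
    have "k = (\<lambda>x. indicator {s..t} x *\<^sub>R f x - indicator {s..t} x *\<^sub>R \<beta>)"
      using st by (auto simp: k_def h_def indicator_def)
    moreover have "integral\<^sup>L lborel (\<lambda>x. indicator {s..t} x *\<^sub>R f x - indicator {s..t} x *\<^sub>R \<beta>)
        = (LINT x:{s..t}|lborel. f x) - \<beta> * (t - s)"
      using st integrable_mult_indicator[OF _ f, of "{s..t}"] unfolding set_lebesgue_integral_def
      by (subst Bochner_Integration.integral_diff)
        (simp_all add: integrable_indicator_iff)
    ultimately have "0 \<le> integral\<^sup>L lborel k" using gt by simp
    then have le: "enn2real (\<integral>\<^sup>+x. ennreal (- k x) \<partial>lborel) \<le> enn2real (\<integral>\<^sup>+x. ennreal (k x) \<partial>lborel)"
      using real_lebesgue_integral_def[OF k] by simp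
    have fin: "(\<integral>\<^sup>+x. ennreal (- k x) \<partial>lborel) \<noteq> \<infinity>" "(\<integral>\<^sup>+x. ennreal (k x) \<partial>lborel) \<noteq> \<infinity>"
      using k by (auto simp: real_integrable_def)
    have "(\<integral>\<^sup>+x. ennreal (- k x) \<partial>lborel) \<le> (\<integral>\<^sup>+x. ennreal (k x) \<partial>lborel)"
      using le fin by (simp add: enn2real_le less_top[symmetric]) (metis ennreal_enn2real ennreal_leI less_top)
    moreover have "ennreal (- k x) = ennreal (- h x) * indicator {s..t} x"
      "ennreal (k x) = ennreal (h x) * indicator {s..t} x" for x
      by (auto simp: k_def indicator_def)
    ultimately show ?thesis by (simp add: eP eN)
  qed
  have "emeasure N E \<le> ennreal e" if e: "e > 0" for e
  proof -
    have "(INF U \<in> {U. E \<subseteq> U \<and> open U}. emeasure P U) < ennreal e"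
      using outer_regular[of P E] P_fin PE e by simp
    then obtain O' where O': "E \<subseteq> O'" "open O'" "emeasure P O' < ennreal e"
      by (auto simp: INF_less_iff)
    define V where "V = O' \<inter> {a<..<b}"
    have V: "E \<subseteq> V" "open V" using O' by (auto simp: V_def E_def)
    define K where "K = {(s, t). s < t \<and> {s..t} \<subseteq> V \<and> \<beta> * (t - s) \<le> (LINT x:{s..t}|lborel. f x)}"
    define ce where "ce = (\<lambda>(s, t). (s + t) / 2 :: real)"
    define ra where "ra = (\<lambda>(s, t). (t - s) / 2 :: real)"
    have ball: "cball (ce i) (ra i) = {fst i..snd i}" for i
      by (cases i) (auto simp: ce_def ra_def cball_eq_atLeastAtMost field_simps)
    have cov: "\<exists>i. i \<in> K \<and> x \<in> cball (ce i) (ra i) \<and> ra i < d" if x: "x \<in> E" and d: "0 < d" for x d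
    proof -
      from V x obtain r where r: "r > 0" "ball x r \<subseteq> V" by (meson open_contains_ball subsetD)
      obtain n :: nat where n: "1 / (real n + 1) < min r d"
        using nat_approx_posE[of "min r d"] r d by (auto simp: add.commute)
      from x obtain q where q: "q \<noteq> x" "\<bar>q - x\<bar> < 1 / (real n + 1)" "\<beta> < (F q - F x) / (q - x)"
        by (auto simp: E_def)
      define s t where "s = min q x" and "t = max q x"
      have st: "s < t" "x \<in> {s..t}" "t - s < r" "t - s < d"
        using q n by (auto simp: s_def t_def)
      have sub: "{s..t} \<subseteq> V"
        using r(2) st by (force simp: dist_real_def subset_eq)
      have "\<beta> < (F t - F s) / (t - s)"
        using q by (auto simp: s_def t_def min_def max_def field_simps split: if_splits)
      then have "\<beta> * (t - s) \<le> F t - F s" using st by (simp add: field_simps)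
      also have "\<dots> = (LINT x:{s..t}|lborel. f x)"
        unfolding F_def using set_integral_atMost_diff[OF f, of s t] st by simp
      finally have "(s, t) \<in> K" using st sub by (auto simp: K_def)
      moreover have "ra (s, t) < d" using st by (simp add: ra_def)
      ultimately show ?thesis using st ball[of "(s, t)"] by (intro exI[of _ "(s, t)"]) auto
    qed
    have pos: "0 < ra i" if "i \<in> K" for i using that by (auto simp: K_def ra_def)
    obtain C where C: "countable C" "C \<subseteq> K"
      and disj: "pairwise (\<lambda>i j. disjnt (cball (ce i) (ra i)) (cball (ce j) (ra j))) C"
      and neg: "negligible (E - (\<Union>i\<in>C. cball (ce i) (ra i)))"
      by (rule Vitali_covering_theorem_cballs[of K ra E ce, OF pos cov])
    define U where "U = (\<Union>i\<in>C. {fst i..snd i})"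
    have [measurable]: "U \<in> sets borel" unfolding U_def using C by (intro sets.countable_UN') auto
    have UV: "U \<subseteq> V" using C(2) by (fastforce simp: U_def K_def)
    have dC: "disjoint_family_on (\<lambda>i. {fst i..snd i}) C"
      using disj by (auto simp: disjoint_family_on_def pairwise_def disjnt_def ball)
    have "E - U \<in> null_sets lebesgue"
      using neg by (simp add: U_def ball negligible_iff_null_sets)
    then have "E - U \<in> null_sets lborel" by (simp add: null_sets_completion_iff)
    then have nullN: "emeasure N (E - U) = 0"
      unfolding N_def by (subst emeasure_density) (auto intro!: nn_integral_null_set dest: null_setsD2)
    have "emeasure N E \<le> emeasure N ((E - U) \<union> U)" by (intro emeasure_mono) auto
    also have "\<dots> \<le> emeasure N (E - U) + emeasure N U" by (intro emeasure_subadditive) auto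
    also have "\<dots> = emeasure N U" using nullN by simp
    also have "\<dots> = (\<integral>\<^sup>+i. emeasure N {fst i..snd i} \<partial>count_space C)"
      unfolding U_def using C dC by (intro emeasure_UN_countable) auto
    also have "\<dots> \<le> (\<integral>\<^sup>+i. emeasure P {fst i..snd i} \<partial>count_space C)"
    proof (intro nn_integral_mono)
      fix i assume "i \<in> space (count_space C)"
      then obtain s t where i: "i = (s, t)" "s < t" "{s..t} \<subseteq> V"
        "\<beta> * (t - s) \<le> (LINT x:{s..t}|lborel. f x)" using C(2) by (auto simp: K_def)
      then have "s \<in> V" "t \<in> V" by auto
      then show "emeasure N {fst i..snd i} \<le> emeasure P {fst i..snd i}"
        using N_le_P[of s t] i by (auto simp: V_def)
    qed
    also have "\<dots> = emeasure P U"
      unfolding U_def using C dC by (intro emeasure_UN_countable[symmetric]) auto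
    also have "\<dots> \<le> emeasure P O'" using UV O' by (intro emeasure_mono) (auto simp: V_def)
    also have "\<dots> \<le> ennreal e" using O' by simp
    finally show ?thesis .
  qed
  then have "emeasure N E = 0"
    using ennreal_le_epsilon[of 0 "emeasure N E"] by simp
  then have "AE x in lborel. ennreal (- h x) * indicator E x = 0"
    by (subst (asm) eN) (auto simp: nn_integral_0_iff_AE)
  moreover have "ennreal (- h x) * indicator E x \<noteq> 0" if "x \<in> E" for x
    using that by (auto simp: E_def h_def)
  ultimately have "AE x in lborel. x \<notin> E" by (auto elim!: eventually_mono)
  then show ?thesis by (simp add: AE_iff_null_sets)
qed

text \<open>
  Continuity of the indefinite integral removes the restriction to rational points.
\<close>

lemma AE_upper_derivative_le:
  fixes f :: "real \<Rightarrow> real"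
  assumes f: "integrable lborel f"
  defines "F \<equiv> \<lambda>t. LINT x:{..t}|lborel. f x"
  shows "AE t in lborel. a < t \<and> t < b \<longrightarrow>
    (\<forall>\<beta>>f t. \<forall>\<^sub>F s in at t. (F s - F t) / (s - t) \<le> \<beta>)"
proof -
  have "AE t in lborel. \<forall>\<beta>\<in>\<rat>. \<not> (a < t \<and> t < b \<and> f t < \<beta> \<and>
    (\<forall>n::nat. \<exists>q\<in>\<rat>. q \<noteq> t \<and> \<bar>q - t\<bar> < 1 / (real n + 1) \<and> \<beta> < (F q - F t) / (q - t)))"
  proof (subst AE_ball_countable[OF countable_rat], intro ballI)
    fix \<beta> :: real
    from AE_not_in[OF null_set_upper_derivative_gt[OF f, of a b \<beta>]]
    show "AE t in lborel. \<not> (a < t \<and> t < b \<and> f t < \<beta> \<and>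
      (\<forall>n::nat. \<exists>q\<in>\<rat>. q \<noteq> t \<and> \<bar>q - t\<bar> < 1 / (real n + 1) \<and> \<beta> < (F q - F t) / (q - t)))"
      by eventually_elim (auto simp: F_def)
  qed
  then show ?thesis
  proof (eventually_elim, intro impI allI)
    fix t \<beta> :: real
    assume H: "\<forall>\<beta>\<in>\<rat>. \<not> (a < t \<and> t < b \<and> f t < \<beta> \<and>
      (\<forall>n::nat. \<exists>q\<in>\<rat>. q \<noteq> t \<and> \<bar>q - t\<bar> < 1 / (real n + 1) \<and> \<beta> < (F q - F t) / (q - t)))"
      and t: "a < t \<and> t < b" and \<beta>: "f t < \<beta>"
    from Rats_dense_in_real[OF \<beta>] obtain \<gamma> where \<gamma>: "\<gamma> \<in> \<rat>" "f t < \<gamma>" "\<gamma> < \<beta>" by blast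
    from bspec[OF H \<gamma>(1)] \<gamma>(2) t obtain n :: nat
      where nq: "\<not> (\<exists>q\<in>\<rat>. q \<noteq> t \<and> \<bar>q - t\<bar> < 1 / (real n + 1) \<and> \<gamma> < (F q - F t) / (q - t))"
      by (simp only: de_Morgan_conj not_all simp_thms) (elim exE)
    have n: "(F q - F t) / (q - t) \<le> \<gamma>" if "q \<in> \<rat>" "q \<noteq> t" "\<bar>q - t\<bar> < 1 / (real n + 1)" for q
    proof (rule ccontr)
      assume "\<not> ?thesis"
      with that have "\<exists>q\<in>\<rat>. q \<noteq> t \<and> \<bar>q - t\<bar> < 1 / (real n + 1) \<and> \<gamma> < (F q - F t) / (q - t)"
        by (intro bexI[of _ q]) auto
      with nq show False by contradiction
    qed
    have "(F s - F t) / (s - t) \<le> \<beta>" if s: "s \<noteq> t" "\<bar>s - t\<bar> < 1 / (real n + 1)" for s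
    proof (rule ccontr)
      assume "\<not> ?thesis"
      then have gt: "\<gamma> < (F s - F t) / (s - t)" using \<gamma> by simp
      \<comment> \<open>the difference quotient is continuous in \<open>s\<close>, so a rational point near \<open>s\<close> violates the bound too\<close>
      have "isCont F s" using set_integral_atMost_continuous[OF f, of UNIV]
        by (simp add: F_def continuous_on_eq_continuous_at)
      then have "isCont (\<lambda>s. (F s - F t) / (s - t)) s" using s by (intro continuous_intros) auto
      then have "((\<lambda>s. (F s - F t) / (s - t)) \<longlongrightarrow> (F s - F t) / (s - t)) (nhds s)"
        using tendsto_at_iff_tendsto_nhds[of "\<lambda>s. (F s - F t) / (s - t)" s] by (simp add: isCont_def)
      then have ev: "\<forall>\<^sub>F r in nhds s. \<gamma> < (F r - F t) / (r - t)"
        using gt by (rule order_tendstoD(1))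
      have "\<forall>\<^sub>F r in nhds s. r \<in> - {t} \<inter> ball t (1 / (real n + 1))"
        using s by (intro eventually_nhds_in_open open_Int open_Compl) (simp_all add: dist_real_def abs_minus_commute)
      with ev have "\<forall>\<^sub>F r in nhds s. \<gamma> < (F r - F t) / (r - t) \<and> r \<noteq> t \<and> \<bar>r - t\<bar> < 1 / (real n + 1)"
        by eventually_elim (auto simp: dist_real_def)
      then obtain d where "d > 0" and d: "\<forall>r. dist r s < d \<longrightarrow> \<gamma> < (F r - F t) / (r - t) \<and> r \<noteq> t \<and> \<bar>r - t\<bar> < 1 / (real n + 1)"
        unfolding eventually_nhds_metric by (elim exE conjE) (rule that)
      from \<open>d > 0\<close> obtain q where "q \<in> \<rat>" "s < q" "q < s + d" using Rats_dense_in_real[of s "s + d"] by auto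
      with d[rule_format, of q] n[of q] show False by (auto simp: dist_real_def)
    qed
    then have q_le: "s \<noteq> t \<and> \<bar>s - t\<bar> < 1 / (real n + 1) \<Longrightarrow> (F s - F t) / (s - t) \<le> \<beta>" for s
      by blast
    have "\<forall>\<^sub>F s in at t. s \<noteq> t \<and> \<bar>s - t\<bar> < 1 / (real n + 1)"
      unfolding eventually_at by (intro exI[of _ "1 / (real n + 1)"]) (auto simp: dist_real_def)
    then show "\<forall>\<^sub>F s in at t. (F s - F t) / (s - t) \<le> \<beta>" by (rule eventually_mono) (rule q_le)
  qed
qed

text \<open>
  The upper derivative is at most \<open>f\<close> almost everywhere; the same bound for \<open>- f\<close> gives the lower
  derivative.
\<close>

theorem Lebesgue_differentiation:
  fixes f :: "real \<Rightarrow> real"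
  assumes f: "integrable lborel f"
  shows "AE t in lborel. ((\<lambda>t. LINT x:{..t}|lborel. f x) has_real_derivative f t) (at t)"
proof -
  have g: "integrable lborel (\<lambda>x. - f x)" using f by simp
  have neg: "(LINT x:{..t}|lborel. - f x) = - (LINT x:{..t}|lborel. f x)" for t
    unfolding set_lebesgue_integral_def by simp
  have bounded: "AE t in lborel. a < t \<and> t < b \<longrightarrow> ((\<lambda>t. LINT x:{..t}|lborel. f x) has_real_derivative f t) (at t)" for a b
    using AE_upper_derivative_le[OF f, of a b] AE_upper_derivative_le[OF g, of a b]
  proof (eventually_elim, intro impI)
    fix t
    let ?F = "\<lambda>t. LINT x:{..t}|lborel. f x"
    assume 1: "a < t \<and> t < b \<longrightarrow> (\<forall>\<beta>>f t. \<forall>\<^sub>F s in at t. (?F s - ?F t) / (s - t) \<le> \<beta>)"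
      and 2: "a < t \<and> t < b \<longrightarrow> (\<forall>\<beta>>- f t. \<forall>\<^sub>F s in at t.
        ((LINT x:{..s}|lborel. - f x) - (LINT x:{..t}|lborel. - f x)) / (s - t) \<le> \<beta>)"
      and t: "a < t \<and> t < b"
    have "((\<lambda>s. (?F s - ?F t) / (s - t)) \<longlongrightarrow> f t) (at t)"
    proof (rule order_tendstoI)
      fix y assume "y < f t"
      then obtain z where z: "y < z" "z < f t" using dense by blast
      with 2 t have "\<forall>\<^sub>F s in at t. (- ?F s - (- ?F t)) / (s - t) \<le> - z" unfolding neg by auto
      then show "\<forall>\<^sub>F s in at t. y < (?F s - ?F t) / (s - t)"
      proof eventually_elim
        case (elim s)
        have "(- ?F s - (- ?F t)) / (s - t) = - ((?F s - ?F t) / (s - t))"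
          by (simp add: minus_divide_left)
        with elim z show ?case by linarith
      qed
    next
      fix y assume "f t < y"
      then obtain z where "f t < z" "z < y" using dense by blast
      with 1 t have "\<forall>\<^sub>F s in at t. (?F s - ?F t) / (s - t) \<le> z" by auto
      then show "\<forall>\<^sub>F s in at t. (?F s - ?F t) / (s - t) < y"
        by eventually_elim (use \<open>z < y\<close> in simp)
    qed
    then show "(?F has_real_derivative f t) (at t)" by (simp add: has_field_derivative_iff)
  qed
  have "AE t in lborel. \<forall>n. - real n < t \<and> t < real n \<longrightarrow>
      ((\<lambda>t. LINT x:{..t}|lborel. f x) has_real_derivative f t) (at t)"
    unfolding AE_all_countable by (intro allI bounded)
  then show ?thesis
  proof eventually_elim
    case (elim t)
    obtain n where "\<bar>t\<bar> < real n" using reals_Archimedean2 by (rule exE)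
    then have "- real n < t \<and> t < real n" by linarith
    with elim show ?case by (elim allE[of _ n]) (rule mp)
  qed
qed

section \<open>Functions with dominated increments\<close>

lemma set_nn_integral_eq_ennreal:
  fixes f :: "'a \<Rightarrow> real"
  assumes f: "integrable M f" "\<And>x. 0 \<le> f x" and A: "A \<in> sets M"
  shows "(\<integral>\<^sup>+x\<in>A. ennreal (f x) \<partial>M) = ennreal (LINT x:A|M. f x)"
proof -
  have "integrable M (\<lambda>x. indicator A x * f x)" using integrable_mult_indicator[OF A f(1)] by simp
  then have "(\<integral>\<^sup>+x. ennreal (indicator A x * f x) \<partial>M) = ennreal (LINT x:A|M. f x)"
    unfolding set_lebesgue_integral_def using f(2) by (subst nn_integral_eq_integral) auto
  moreover have "ennreal (indicator A x * f x) = ennreal (f x) * indicator A x" for x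
    by (auto simp: indicator_def)
  ultimately show ?thesis by simp
qed

text \<open>
  The two measures agree on half-open intervals, which generate the Borel sets. Consequently each of
  the two Lebesgue--Stieltjes measures is dominated by a measure with a density, and is therefore
  absolutely continuous itself.
\<close>

lemma interval_measure_add_eq_density:
  fixes F G m :: "real \<Rightarrow> real"
  assumes F: "mono F" "continuous_on UNIV F" and G: "mono G" "continuous_on UNIV G"
    and m: "integrable lborel m" "\<And>x. 0 \<le> m x"
    and sum: "\<And>s t. s \<le> t \<Longrightarrow> F t - F s + (G t - G s) = (LINT x:{s..t}|lborel. m x)"
    and A: "A \<in> sets borel"
  shows "emeasure (interval_measure F) A + emeasure (interval_measure G) A
    = emeasure (density lborel (\<lambda>x. ennreal (m x))) A"
proof -
  let ?I = "interval_measure F" and ?J = "interval_measure G"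
  let ?D = "density lborel (\<lambda>x. ennreal (m x))"
  have [measurable]: "m \<in> borel_measurable borel" using m by auto
  define S where "S = measure_of UNIV (sets borel) (\<lambda>A. emeasure ?I A + emeasure ?J A)"
  have eS: "emeasure S A = emeasure ?I A + emeasure ?J A" if "A \<in> sets borel" for A
  proof (rule emeasure_measure_of[OF S_def])
    show "positive (sets S) (\<lambda>A. emeasure ?I A + emeasure ?J A)" by (simp add: positive_def)
    show "countably_additive (sets S) (\<lambda>A. emeasure ?I A + emeasure ?J A)"
    proof (rule countably_additiveI)
      fix B :: "nat \<Rightarrow> real set" assume B: "range B \<subseteq> sets S" "disjoint_family B"
      then have "range B \<subseteq> sets borel" by (simp add: S_def sets.sigma_sets_eq[of borel, simplified])
      with B show "(\<Sum>i. emeasure ?I (B i) + emeasure ?J (B i)) = emeasure ?I (\<Union>i. B i) + emeasure ?J (\<Union>i. B i)"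
        by (simp add: suminf_add[symmetric] suminf_emeasure)
    qed
  qed (use that in \<open>auto simp: S_def sets.sigma_sets_eq[of borel, simplified]\<close>)
  have eI: "emeasure ?I {s<..t} = ennreal (F t - F s)" if "s \<le> t" for s t
    using F that
    by (intro emeasure_interval_measure_Ioc)
      (auto simp: mono_def continuous_on_eq_continuous_within intro: continuous_within_subset)
  have eJ: "emeasure ?J {s<..t} = ennreal (G t - G s)" if "s \<le> t" for s t
    using G that
    by (intro emeasure_interval_measure_Ioc)
      (auto simp: mono_def continuous_on_eq_continuous_within intro: continuous_within_subset)
  have eD: "emeasure ?D {s<..t} = ennreal (LINT x:{s..t}|lborel. m x)" if "s \<le> t" for s t
  proof -
    have "AE x in lborel. ennreal (m x) * indicator {s<..t} x = ennreal (m x) * indicator {s..t} x"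
      using AE_lborel_singleton[of s] by eventually_elim (auto simp: indicator_def)
    then have "(\<integral>\<^sup>+x\<in>{s<..t}. ennreal (m x) \<partial>lborel) = (\<integral>\<^sup>+x\<in>{s..t}. ennreal (m x) \<partial>lborel)"
      by (rule nn_integral_cong_AE)
    then show ?thesis using set_nn_integral_eq_ennreal[OF m, of "{s..t}"] by (simp add: emeasure_density)
  qed
  have eq: "emeasure S {s<..t} = emeasure ?D {s<..t}" for s t
  proof (cases "s \<le> t")
    case True
    then have "0 \<le> F t - F s" "0 \<le> G t - G s" using F G by (auto simp: mono_def)
    then show ?thesis
      using True by (simp add: eS eI eJ eD sum[symmetric] ennreal_plus[symmetric] del: ennreal_plus)
  qed simp
  have "S = ?D"
  proof (rule measure_eqI_generator_eq[where E = "range (\<lambda>(a, b). {a<..b::real})" and \<Omega> = UNIV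
      and A = "\<lambda>n. {- real n<..real n}"])
    show "Int_stable (range (\<lambda>(a, b). {a<..b::real}))"
      by (auto simp: Int_stable_def)
    show "sets S = sigma_sets UNIV (range (\<lambda>(a, b). {a<..b::real}))"
      "sets ?D = sigma_sets UNIV (range (\<lambda>(a, b). {a<..b::real}))"
      by (simp_all add: S_def sets.sigma_sets_eq[of borel, simplified])
        (simp_all add: borel_sigma_sets_Ioc)
    show "(\<Union>n. {- real n<..real n}) = UNIV"
    proof (safe, simp_all)
      fix x :: real
      obtain n where "\<bar>x\<bar> < real n" using reals_Archimedean2 by blast
      then show "\<exists>n. - real n < x \<and> x \<le> real n" by (intro exI[of _ n]) auto
    qed
    show "emeasure S {- real n<..real n} \<noteq> \<infinity>" for n by (simp add: eq eD)
  qed (auto simp: eq)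
  then show ?thesis using eS[OF A] by simp
qed

text \<open>
  With \<open>\<Phi>\<close> the indefinite integral of \<open>m\<close>, both \<open>\<Phi> + \<phi>\<close> and \<open>\<Phi> - \<phi>\<close> are increasing, and their sum
  is \<open>2 \<Phi>\<close>. So their Stieltjes measures have densities \<open>f\<close> and \<open>g\<close> with \<open>f + g = 2 m\<close>, and \<open>f - m\<close>,
  which lies between \<open>- m\<close> and \<open>m\<close>, is the required integrand.
\<close>

theorem dominated_increments_imp_indefinite_integral:
  fixes \<phi> m :: "real \<Rightarrow> real"
  assumes m: "integrable lborel m" "\<And>x. 0 \<le> m x"
    and \<phi>: "\<And>s t. s \<le> t \<Longrightarrow> \<bar>\<phi> t - \<phi> s\<bar> \<le> (LINT x:{s..t}|lborel. m x)"
  obtains w where "integrable lborel w" "\<And>x. \<bar>w x\<bar> \<le> m x"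
    "\<And>s t. s \<le> t \<Longrightarrow> \<phi> t - \<phi> s = (LINT x:{s..t}|lborel. w x)"
proof -
  have [measurable]: "m \<in> borel_measurable borel" using m by auto
  define \<Phi> where "\<Phi> = (\<lambda>t. LINT x:{..t}|lborel. m x)"
  have \<Phi>_diff: "\<Phi> t - \<Phi> s = (LINT x:{s..t}|lborel. m x)" if "s \<le> t" for s t
    unfolding \<Phi>_def using that by (rule set_integral_atMost_diff[OF m(1)])
  have inc: "\<bar>\<phi> t - \<phi> s\<bar> \<le> \<Phi> t - \<Phi> s" if "s \<le> t" for s t
    using \<phi>[OF that] \<Phi>_diff[OF that] by simp
  have \<Phi>_cont: "continuous_on UNIV \<Phi>" unfolding \<Phi>_def by (rule set_integral_atMost_continuous[OF m(1)])
  have \<phi>_cont: "continuous_on UNIV \<phi>"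
  proof -
    have "(\<phi> \<longlongrightarrow> \<phi> t) (at t)" for t
    proof -
      have "(\<Phi> \<longlongrightarrow> \<Phi> t) (at t)" using \<Phi>_cont by (simp add: continuous_on_def)
      then have lim0: "((\<lambda>s. \<bar>\<Phi> s - \<Phi> t\<bar>) \<longlongrightarrow> 0) (at t)" by (intro tendsto_rabs_zero LIM_zero)
      have "\<bar>\<phi> s - \<phi> t\<bar> \<le> \<bar>\<Phi> s - \<Phi> t\<bar>" for s
      proof (cases "s \<le> t")
        case True
        from inc[OF this] show ?thesis by linarith
      next
        case False
        then have "t \<le> s" by simp
        from inc[OF this] show ?thesis by linarith
      qed
      then have "\<forall>\<^sub>F s in at t. norm (\<phi> s - \<phi> t) \<le> \<bar>\<Phi> s - \<Phi> t\<bar>" by simp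
      from Lim_null_comparison[OF this lim0] have "((\<lambda>s. \<phi> s - \<phi> t) \<longlongrightarrow> 0) (at t)" .
      then show ?thesis by (rule LIM_zero_cancel)
    qed
    then show ?thesis by (simp add: continuous_on_def)
  qed
  define F where "F = (\<lambda>t. \<Phi> t + \<phi> t)"
  define G where "G = (\<lambda>t. \<Phi> t - \<phi> t)"
  have monoF: "mono F" and monoG: "mono G"
  proof -
    have "F s \<le> F t \<and> G s \<le> G t" if "s \<le> t" for s t
      using inc[OF that] by (simp add: F_def G_def abs_le_iff)
    then show "mono F" "mono G" by (auto intro: monoI)
  qed
  have contF: "continuous_on UNIV F" and contG: "continuous_on UNIV G"
    unfolding F_def G_def using \<Phi>_cont \<phi>_cont by (auto intro: continuous_intros)
  let ?m2 = "\<lambda>x. 2 * m x"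
  let ?D = "density lborel (\<lambda>x. ennreal (?m2 x))"
  have m2: "integrable lborel ?m2" "\<And>x. 0 \<le> ?m2 x" using m by auto
  have sum: "F t - F s + (G t - G s) = (LINT x:{s..t}|lborel. ?m2 x)" if "s \<le> t" for s t
    using \<Phi>_diff[OF that] by (simp add: F_def G_def set_integral_mult_right)
  have add: "emeasure (interval_measure F) A + emeasure (interval_measure G) A = emeasure ?D A"
    if "A \<in> sets borel" for A
    using interval_measure_add_eq_density[OF monoF contF monoG contG m2 sum that] by simp
  have ac: "absolutely_continuous lborel (interval_measure F)" "absolutely_continuous lborel (interval_measure G)"
  proof -
    have "emeasure (interval_measure F) A = 0 \<and> emeasure (interval_measure G) A = 0"
      if "A \<in> null_sets lborel" for A
    proof -
      have "A \<in> null_sets ?D"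
        using absolutely_continuousI_density[of "\<lambda>x. ennreal (?m2 x)" lborel] that
        by (auto simp: absolutely_continuous_def)
      then have "emeasure ?D A = 0" "A \<in> sets borel" by auto
      then show ?thesis using add[of A] by simp
    qed
    then show "absolutely_continuous lborel (interval_measure F)"
      "absolutely_continuous lborel (interval_measure G)"
      by (auto simp: absolutely_continuous_def null_sets_def)
  qed
  obtain f where f[measurable]: "f \<in> borel_measurable borel" and df: "density lborel f = interval_measure F"
    using sigma_finite_measure.Radon_Nikodym[OF sigma_finite_lborel ac(1)] by auto
  obtain g where g[measurable]: "g \<in> borel_measurable borel" and dg: "density lborel g = interval_measure G"
    using sigma_finite_measure.Radon_Nikodym[OF sigma_finite_lborel ac(2)] by auto
  have "density lborel (\<lambda>x. f x + g x) = ?D"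
  proof (rule measure_eqI)
    fix A assume "A \<in> sets (density lborel (\<lambda>x. f x + g x))"
    then have A[measurable]: "A \<in> sets borel" by simp
    have "emeasure (density lborel (\<lambda>x. f x + g x)) A = emeasure (density lborel f) A + emeasure (density lborel g) A"
      by (simp add: emeasure_density distrib_right nn_integral_add)
    then show "emeasure (density lborel (\<lambda>x. f x + g x)) A = emeasure ?D A"
      using add[OF A] by (simp add: df dg)
  qed simp
  then have fg: "AE x in lborel. f x + g x = ennreal (?m2 x)"
    by (intro sigma_finite_measure.density_unique[OF sigma_finite_lborel]) auto
  \<comment> \<open>\<open>f \<le> 2 m\<close> holds only almost everywhere; the bound \<open>\<bar>w x\<bar> \<le> m x\<close> is needed at every point\<close>
  define w where "w = (\<lambda>x. if f x \<le> ennreal (?m2 x) then enn2real (f x) - m x else 0)"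
  have w_bd: "\<bar>w x\<bar> \<le> m x" for x
  proof (cases "f x \<le> ennreal (?m2 x)")
    case True
    then have "enn2real (f x) \<le> ?m2 x" using m(2) by (intro enn2real_leI) auto
    then show ?thesis using True enn2real_nonneg[of "f x"] by (auto simp: w_def abs_le_iff)
  qed (use m(2) in \<open>auto simp: w_def\<close>)
  have wm: "0 \<le> w x + m x" for x using w_bd[of x] by linarith
  have w: "integrable lborel w"
    by (rule Bochner_Integration.integrable_bound[OF m(1)]) (use w_bd m(2) in \<open>auto simp: w_def\<close>)
  have eq: "\<phi> t - \<phi> s = (LINT x:{s..t}|lborel. w x)" if st: "s \<le> t" for s t
  proof -
    have "ennreal (F t - F s) = emeasure (interval_measure F) {s..t}"
      using monoF contF st
      by (intro emeasure_interval_measure_Icc[symmetric]) (auto simp: mono_def intro: continuous_on_subset)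
    also have "\<dots> = (\<integral>\<^sup>+x\<in>{s..t}. f x \<partial>lborel)" by (simp add: df[symmetric] emeasure_density)
    also have "\<dots> = (\<integral>\<^sup>+x\<in>{s..t}. ennreal (w x + m x) \<partial>lborel)"
    proof (rule nn_integral_cong_AE)
      show "AE x in lborel. f x * indicator {s..t} x = ennreal (w x + m x) * indicator {s..t} x"
        using fg
      proof eventually_elim
        case (elim x)
        then have le: "f x \<le> ennreal (?m2 x)" by (metis le_iff_add)
        then have "f x < top" using order.strict_trans1 ennreal_less_top by blast
        then show ?case using le by (simp add: w_def)
      qed
    qed
    also have "\<dots> = ennreal (LINT x:{s..t}|lborel. w x + m x)"
      using wm w m by (intro set_nn_integral_eq_ennreal) auto
    finally have "F t - F s = (LINT x:{s..t}|lborel. w x + m x)"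
      using monoF st wm
      by (subst (asm) ennreal_inj)
        (auto simp: mono_def set_lebesgue_integral_def intro!: Bochner_Integration.integral_nonneg)
    also have "\<dots> = (LINT x:{s..t}|lborel. w x) + (LINT x:{s..t}|lborel. m x)"
      unfolding set_integrable_def by (intro set_integral_add) (auto simp: set_integrable_def intro!: integrable_mult_indicator w m simp del: real_scaleR_def)
    finally show ?thesis using \<Phi>_diff[OF st] by (simp add: F_def)
  qed
  show thesis using that[OF w w_bd eq] .
qed

section \<open>The metric derivative of an absolutely continuous curve\<close>

text \<open>
  Passing from a Lebesgue measurable bound to a nonnegative Borel measurable one that is integrable on
  the whole line lets all later integrals run over Borel sets.
\<close>

lemma ac_curves_borel_bound:
  assumes "c \<in> ac_curves a b X d"
  obtains m where "integrable lborel m" "\<And>x. 0 \<le> m x"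
    "\<And>s t. a \<le> s \<Longrightarrow> s \<le> t \<Longrightarrow> t \<le> b \<Longrightarrow> d (c s) (c t) \<le> (LINT r:{s..t}|lborel. m r)"
proof -
  obtain m0 where m0: "set_integrable lebesgue {a..b} m0"
    and d: "\<And>s t. a \<le> s \<Longrightarrow> s \<le> t \<Longrightarrow> t \<le> b \<Longrightarrow> d (c s) (c t) \<le> (LINT r:{s..t}|lebesgue. m0 r)"
    using assms by (auto simp: ac_curves_def)
  define g where "g = (\<lambda>x. indicator {a..b} x * m0 x)"
  have g: "integrable lebesgue g" using m0 by (simp add: set_integrable_def g_def)
  then obtain g' where g'[measurable]: "g' \<in> borel_measurable lborel" and ae: "AE x in lborel. g x = g' x"
    using completion_ex_borel_measurable_real[of g lborel] by auto
  have ae': "AE x in lebesgue. g x = g' x" using ae by (rule AE_completion)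
  have "integrable lebesgue g'"
    by (rule integrable_cong_AE_imp[OF g _ ae']) (rule measurable_completion[OF g'])
  then have int: "integrable lborel g'" by (simp add: integrable_completion)
  have "d (c s) (c t) \<le> (LINT r:{s..t}|lborel. \<bar>g' r\<bar>)" if st: "a \<le> s" "s \<le> t" "t \<le> b" for s t
  proof -
    have "(LINT r:{s..t}|lebesgue. m0 r) = integral\<^sup>L lebesgue (\<lambda>r. indicator {s..t} r * g r)"
      unfolding set_lebesgue_integral_def g_def using st
      by (intro Bochner_Integration.integral_cong) (auto simp: indicator_def)
    also have "\<dots> = integral\<^sup>L lebesgue (\<lambda>r. indicator {s..t} r * g' r)"
    proof (rule integral_cong_AE)
      show "(\<lambda>r. indicat_real {s..t} r * g r) \<in> borel_measurable lebesgue"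
        using g by (intro borel_measurable_times borel_measurable_indicator) auto
      show "(\<lambda>r. indicat_real {s..t} r * g' r) \<in> borel_measurable lebesgue"
        using measurable_completion[OF g'] by (intro borel_measurable_times borel_measurable_indicator) auto
    qed (use ae' in eventually_elim, simp)
    also have "\<dots> = integral\<^sup>L lborel (\<lambda>r. indicator {s..t} r * g' r)"
      by (intro integral_completion) measurable
    also have "\<dots> \<le> integral\<^sup>L lborel (\<lambda>r. indicator {s..t} r * \<bar>g' r\<bar>)"
      using integrable_mult_indicator[OF _ int, of "{s..t}"]
        integrable_mult_indicator[OF _ integrable_abs[OF int], of "{s..t}"]
      by (intro integral_mono) (auto simp: indicator_def)
    finally show ?thesis using d[OF st] by (simp add: set_lebesgue_integral_def)
  qed
  then show thesis using int by (intro that[of "\<lambda>x. \<bar>g' x\<bar>"]) auto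
qed

text \<open>
  The form of the squeeze argument that identifies a metric derivative: a supremum of limits from below
  against a single limit from above.
\<close>

lemma tendsto_squeeze_SUP:
  fixes f u :: "'a \<Rightarrow> real" and L :: "'i \<Rightarrow> real"
  assumes I: "I \<noteq> {}" "bdd_above (L ` I)"
    and low: "\<And>i. i \<in> I \<Longrightarrow> (l i \<longlongrightarrow> L i) F" "\<And>i. i \<in> I \<Longrightarrow> \<forall>\<^sub>F s in F. l i s \<le> f s"
    and up: "(u \<longlongrightarrow> (SUP i\<in>I. L i)) F" "\<forall>\<^sub>F s in F. f s \<le> u s"
  shows "(f \<longlongrightarrow> (SUP i\<in>I. L i)) F"
proof (rule order_tendstoI)
  fix y assume "y < (SUP i\<in>I. L i)"
  then obtain i where i: "i \<in> I" "y < L i" using I by (auto simp: less_cSUP_iff)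
  from order_tendstoD(1)[OF low(1)[OF i(1)] i(2)] low(2)[OF i(1)]
  show "\<forall>\<^sub>F s in F. y < f s" by eventually_elim simp
next
  fix y assume "(SUP i\<in>I. L i) < y"
  from order_tendstoD(2)[OF up(1) this] up(2)
  show "\<forall>\<^sub>F s in F. f s < y" by eventually_elim simp
qed

text \<open>
  For fixed \<open>q\<close> the distance of \<open>c t\<close> to \<open>c q\<close> is a real function of \<open>t\<close> whose increments are dominated
  by those of an indefinite integral, so it is the indefinite integral of some \<open>W q\<close>. Let \<open>w\<close> be the
  supremum of the \<open>\<bar>W q\<bar>\<close> over rational \<open>q\<close>. By the triangle inequality each \<open>\<bar>W q\<bar>\<close> bounds the metric
  derivative from below. Conversely \<open>d (c s) (c t)\<close> is the supremum over \<open>q\<close> of the differences of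
  distances to \<open>c q\<close>, hence at most the integral of \<open>w\<close>, and \<open>w\<close> bounds the metric derivative from
  above. At almost every point all these indefinite integrals are differentiable.
\<close>

theorem ac_curve_metric_derivative:
  assumes X: "Metric_space X d" and ab: "a < b" and c: "c \<in> ac_curves a b X d"
  obtains w where "integrable lborel w" "\<And>x. 0 \<le> w x"
    "\<And>s t. a \<le> s \<Longrightarrow> s \<le> t \<Longrightarrow> t \<le> b \<Longrightarrow> d (c s) (c t) \<le> (LINT r:{s..t}|lborel. w r)"
    "AE t in lborel. a < t \<and> t < b \<longrightarrow> ((\<lambda>s. d (c s) (c t) / \<bar>s - t\<bar>) \<longlongrightarrow> w t) (at t)"
proof -
  interpret Metric_space X d by (rule X)
  obtain m where m: "integrable lborel m" "\<And>x. 0 \<le> m x"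
    and dm: "\<And>s t. a \<le> s \<Longrightarrow> s \<le> t \<Longrightarrow> t \<le> b \<Longrightarrow> d (c s) (c t) \<le> (LINT r:{s..t}|lborel. m r)"
    using ac_curves_borel_bound[OF c] by blast
  have indint: "integrable lborel (\<lambda>x. indicator A x *\<^sub>R f x)"
    if "integrable lborel f" "A \<in> sets borel" for f :: "real \<Rightarrow> real" and A :: "real set"
    using that by (intro integrable_mult_indicator) auto
  \<comment> \<open>extending \<open>c\<close> by constants makes every rational number available as a parameter \<open>q\<close>\<close>
  define e where "e = (\<lambda>t. c (max a (min b t)))"
  have eX[simp]: "e t \<in> X" for t
    using c ab by (auto simp: e_def ac_curves_def Pi_iff)
  have ec: "e t = c t" if "a \<le> t" "t \<le> b" for t using that by (simp add: e_def)
  have de: "d (e s) (e t) \<le> (LINT r:{s..t}|lborel. m r)" if st: "s \<le> t" for s t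
  proof -
    define s' t' where "s' = max a (min b s)" and "t' = max a (min b t)"
    have st': "a \<le> s'" "s' \<le> t'" "t' \<le> b" using st ab by (auto simp: s'_def t'_def)
    show ?thesis
    proof (cases "s' = t'")
      case True
      then have "d (e s) (e t) = 0" using eX[of s] by (simp add: e_def s'_def t'_def)
      moreover have "0 \<le> (LINT r:{s..t}|lborel. m r)"
        using m(2) unfolding set_lebesgue_integral_def by (intro Bochner_Integration.integral_nonneg) auto
      ultimately show ?thesis by simp
    next
      case False
      then have sub: "{s'..t'} \<subseteq> {s..t}" using st by (auto simp: s'_def t'_def)
      have "d (e s) (e t) \<le> (LINT r:{s'..t'}|lborel. m r)"
        using dm[OF st'] by (simp add: e_def s'_def t'_def)
      also have "\<dots> \<le> (LINT r:{s..t}|lborel. m r)"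
        using sub m(2) unfolding set_lebesgue_integral_def
        by (intro integral_mono indint m(1)) (auto simp: indicator_def)
      finally show ?thesis .
    qed
  qed
  have "\<exists>w. integrable lborel w \<and> (\<forall>x. \<bar>w x\<bar> \<le> m x) \<and>
    (\<forall>s t. s \<le> t \<longrightarrow> d (e q) (e t) - d (e q) (e s) = (LINT x:{s..t}|lborel. w x))" for q
  proof (rule dominated_increments_imp_indefinite_integral[OF m, of "\<lambda>t. d (e q) (e t)"])
    fix s t :: real assume "s \<le> t"
    have "\<bar>d (e q) (e t) - d (e q) (e s)\<bar> \<le> d (e s) (e t)"
      using triangle[of "e q" "e s" "e t"] triangle[of "e q" "e t" "e s"] commute[of "e t" "e s"] by simp
    also have "\<dots> \<le> (LINT x:{s..t}|lborel. m x)" by (rule de) fact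
    finally show "\<bar>d (e q) (e t) - d (e q) (e s)\<bar> \<le> (LINT x:{s..t}|lborel. m x)" .
  qed blast
  then obtain W where W: "\<And>q. integrable lborel (W q)" "\<And>q x. \<bar>W q x\<bar> \<le> m x"
    "\<And>q s t. s \<le> t \<Longrightarrow> d (e q) (e t) - d (e q) (e s) = (LINT x:{s..t}|lborel. W q x)"
    by metis
  define w where "w = (\<lambda>x. SUP q\<in>\<rat>. \<bar>W q x\<bar>)"
  have bdd: "bdd_above ((\<lambda>q. \<bar>W q x\<bar>) ` \<rat>)" for x
    using W(2) by (intro bdd_aboveI[of _ "m x"]) auto
  have W_le_w: "\<bar>W q x\<bar> \<le> w x" if "q \<in> \<rat>" for q x
    unfolding w_def using bdd that by (rule cSUP_upper2) simp
  have w_le_m: "w x \<le> m x" for x unfolding w_def using W(2) by (intro cSUP_least) auto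
  have w_nn: "0 \<le> w x" for x using W_le_w[of 0 x] by simp
  have [measurable]: "W q \<in> borel_measurable lborel" for q using W(1) by auto
  have w_meas: "w \<in> borel_measurable lborel"
    unfolding w_def by (intro borel_measurable_cSUP countable_rat bdd) measurable
  have w: "integrable lborel w"
    using w_le_m w_nn m(2) by (intro Bochner_Integration.integrable_bound[OF m(1) w_meas]) auto
  have dw: "d (e s) (e t) \<le> (LINT r:{s..t}|lborel. w r)" if st: "s \<le> t" for s t
  proof (rule field_le_epsilon)
    fix \<epsilon> :: real assume \<epsilon>: "\<epsilon> > 0"
    \<comment> \<open>choose a rational \<open>q\<close> so close to \<open>s\<close> that \<open>d (e q) (e t)\<close> and \<open>d (e s) (e t)\<close> nearly agree\<close>
    let ?M = "\<lambda>t. LINT r:{..t}|lborel. m r"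
    have "(?M \<longlongrightarrow> ?M s) (at_right s)"
      using set_integral_atMost_continuous[OF m(1), of UNIV]
      by (auto simp: continuous_on_def intro: tendsto_within_subset)
    from order_tendstoD(2)[OF this, of "?M s + \<epsilon> / 2"] \<epsilon>
    obtain u where u: "s < u" "\<And>y. s < y \<Longrightarrow> y < u \<Longrightarrow> ?M y < ?M s + \<epsilon> / 2"
      by (auto simp: eventually_at_right_field)
    obtain q where q: "q \<in> \<rat>" "s < q" "q < u" using Rats_dense_in_real[OF u(1)] by blast
    have "d (e s) (e q) \<le> \<epsilon> / 2"
      using de[of s q] q u(2)[of q] set_integral_atMost_diff[OF m(1), of s q] by simp
    moreover have "d (e q) (e t) - d (e q) (e s) \<le> (LINT r:{s..t}|lborel. w r)"
    proof -
      have "(LINT x:{s..t}|lborel. W q x) \<le> (LINT r:{s..t}|lborel. w r)"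
        unfolding set_lebesgue_integral_def
      proof (intro integral_mono indint W(1) w)
        show "indicat_real {s..t} x *\<^sub>R W q x \<le> indicat_real {s..t} x *\<^sub>R w x" for x
          using W_le_w[OF q(1), of x] by (auto simp: indicator_def)
      qed auto
      then show ?thesis using W(3)[OF st, of q] by simp
    qed
    moreover have "d (e s) (e t) \<le> d (e s) (e q) + d (e q) (e t)" by (intro triangle) auto
    ultimately show "d (e s) (e t) \<le> (LINT r:{s..t}|lborel. w r) + \<epsilon>"
      using commute[of "e q" "e s"] by simp
  qed
  have "AE t in lborel. \<forall>q\<in>\<rat>. ((\<lambda>t. LINT x:{..t}|lborel. W q x) has_real_derivative W q t) (at t)"
    by (subst AE_ball_countable[OF countable_rat]) (intro ballI Lebesgue_differentiation W)
  with Lebesgue_differentiation[OF w]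
  have lim: "AE t in lborel. a < t \<and> t < b \<longrightarrow> ((\<lambda>s. d (c s) (c t) / \<bar>s - t\<bar>) \<longlongrightarrow> w t) (at t)"
  proof (eventually_elim, intro impI)
    fix t assume t: "a < t \<and> t < b"
    let ?\<Phi> = "\<lambda>t. LINT x:{..t}|lborel. w x" and ?\<Psi> = "\<lambda>q t. LINT x:{..t}|lborel. W q x"
    assume "(?\<Phi> has_real_derivative w t) (at t)"
    then have 1: "((\<lambda>s. (?\<Phi> s - ?\<Phi> t) / (s - t)) \<longlongrightarrow> w t) (at t)"
      by (simp add: has_field_derivative_iff)
    have 1: "((\<lambda>s. \<bar>(?\<Phi> s - ?\<Phi> t) / (s - t)\<bar>) \<longlongrightarrow> w t) (at t)"
      using tendsto_rabs[OF 1] w_nn[of t] by simp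
    assume "\<forall>q\<in>\<rat>. (?\<Psi> q has_real_derivative W q t) (at t)"
    then have 2: "((\<lambda>s. (?\<Psi> q s - ?\<Psi> q t) / (s - t)) \<longlongrightarrow> W q t) (at t)" if "q \<in> \<rat>" for q
      using that by (simp add: has_field_derivative_iff)
    have 2: "((\<lambda>s. \<bar>(?\<Psi> q s - ?\<Psi> q t) / (s - t)\<bar>) \<longlongrightarrow> \<bar>W q t\<bar>) (at t)" if "q \<in> \<rat>" for q
      using tendsto_rabs[OF 2[OF that]] .
    have near: "\<forall>\<^sub>F s in at t. s \<in> {a<..<b}"
      using t by (intro eventually_at_in_open') auto
    have diff: "\<bar>?\<Psi> q s - ?\<Psi> q t\<bar> = \<bar>d (e q) (e s) - d (e q) (e t)\<bar>" for q s
      using set_integral_atMost_diff[OF W(1), of s t q] W(3)[of s t q]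
        set_integral_atMost_diff[OF W(1), of t s q] W(3)[of t s q]
      by (cases "s \<le> t") (simp_all add: abs_minus_commute)
    have lower: "\<bar>?\<Psi> q s - ?\<Psi> q t\<bar> \<le> d (e s) (e t)" for q s
      unfolding diff
      using triangle[of "e q" "e s" "e t"] triangle[of "e q" "e t" "e s"] commute[of "e t" "e s"] by simp
    have upper: "d (e s) (e t) \<le> \<bar>?\<Phi> s - ?\<Phi> t\<bar>" for s
      using dw[of s t] dw[of t s] set_integral_atMost_diff[OF w, of s t]
        set_integral_atMost_diff[OF w, of t s] commute[of "e t" "e s"]
      by (cases "s \<le> t") simp_all
    have "((\<lambda>s. d (e s) (e t) / \<bar>s - t\<bar>) \<longlongrightarrow> (SUP q\<in>\<rat>. \<bar>W q t\<bar>)) (at t)"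
    proof (rule tendsto_squeeze_SUP)
      show "\<forall>\<^sub>F s in at t. \<bar>(?\<Psi> q s - ?\<Psi> q t) / (s - t)\<bar> \<le> d (e s) (e t) / \<bar>s - t\<bar>" for q
        using lower by (intro always_eventually allI) (simp add: abs_divide divide_right_mono)
      show "\<forall>\<^sub>F s in at t. d (e s) (e t) / \<bar>s - t\<bar> \<le> \<bar>(?\<Phi> s - ?\<Phi> t) / (s - t)\<bar>"
        using upper by (intro always_eventually allI) (simp add: abs_divide divide_right_mono)
    qed (use 1 2 bdd Rats_0 in \<open>auto simp: w_def\<close>)
    then have "((\<lambda>s. d (e s) (e t) / \<bar>s - t\<bar>) \<longlongrightarrow> w t) (at t)" by (simp add: w_def)
    moreover have "\<forall>\<^sub>F s in at t. d (e s) (e t) / \<bar>s - t\<bar> = d (c s) (c t) / \<bar>s - t\<bar>"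
      using near by eventually_elim (use t in \<open>simp add: ec\<close>)
    ultimately show "((\<lambda>s. d (c s) (c t) / \<bar>s - t\<bar>) \<longlongrightarrow> w t) (at t)"
      by (rule Lim_transform_eventually)
  qed
  have dcw: "d (c s) (c t) \<le> (LINT r:{s..t}|lborel. w r)" if "a \<le> s" "s \<le> t" "t \<le> b" for s t
    using dw[of s t] that by (simp add: ec)
  show thesis using that[OF w w_nn dcw lim] .
qed

section \<open>Midpoints and Lipschitz paths in length spaces\<close>

text \<open>
  The limit defining the metric derivative is \<open>w\<close> off a null set, and that is all the length sees.
\<close>

lemma ac_curve_length:
  assumes X: "Metric_space X d" and ab: "a < b" and c: "c \<in> ac_curves a b X d"
  obtains w where "integrable lborel w" "\<And>x. 0 \<le> w x"
    "\<And>s t. a \<le> s \<Longrightarrow> s \<le> t \<Longrightarrow> t \<le> b \<Longrightarrow> d (c s) (c t) \<le> (LINT r:{s..t}|lborel. w r)"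
    "AE t in lborel. a < t \<and> t < b \<longrightarrow> ((\<lambda>s. d (c s) (c t) / \<bar>s - t\<bar>) \<longlongrightarrow> w t) (at t)"
    "curve_length a b d c = ennreal (LINT r:{a..b}|lborel. w r)"
proof -
  obtain w where w: "integrable lborel w" "\<And>x. 0 \<le> w x"
    "\<And>s t. a \<le> s \<Longrightarrow> s \<le> t \<Longrightarrow> t \<le> b \<Longrightarrow> d (c s) (c t) \<le> (LINT r:{s..t}|lborel. w r)"
    and lim: "AE t in lborel. a < t \<and> t < b \<longrightarrow> ((\<lambda>s. d (c s) (c t) / \<bar>s - t\<bar>) \<longlongrightarrow> w t) (at t)"
    using ac_curve_metric_derivative[OF X ab c] by blast
  have "AE t in lborel. ennreal (metric_deriv a b d c t) * indicator {a..b} t = ennreal (w t) * indicator {a..b} t"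
    using lim AE_lborel_singleton[of a] AE_lborel_singleton[of b]
  proof eventually_elim
    case (elim t)
    show ?case
    proof (cases "a < t \<and> t < b")
      case True
      then have "at t within {a..b} = at t" by (intro at_within_Icc_at) auto
      then have "metric_deriv a b d c t = w t"
        using elim True unfolding metric_deriv_def by (intro tendsto_Lim) auto
      then show ?thesis by simp
    next
      case False
      with elim have "t \<notin> {a..b}" by auto
      then show ?thesis by simp
    qed
  qed
  then have "(\<integral>\<^sup>+t\<in>{a..b}. ennreal (metric_deriv a b d c t) \<partial>lborel) = (\<integral>\<^sup>+t\<in>{a..b}. ennreal (w t) \<partial>lborel)"
    by (rule nn_integral_cong_AE)
  then have "curve_length a b d c = ennreal (LINT r:{a..b}|lborel. w r)"
    using set_nn_integral_eq_ennreal[OF w(1,2), of "{a..b}"]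
    by (simp add: curve_length_def nn_integral_completion)
  with w lim show thesis by (rule that)
qed

text \<open>
  By the intermediate value theorem the integral of the metric derivative over \<open>{a..t}\<close> reaches half of
  its total at some \<open>t\<close>; the two halves of the curve bound the two distances.
\<close>

lemma ac_curve_halfway_point:
  assumes X: "Metric_space X d" and ab: "a < b" and c: "c \<in> ac_curves a b X d"
    and L: "curve_length a b d c \<le> ennreal L" "0 \<le> L"
  obtains t where "a \<le> t" "t \<le> b" "d (c a) (c t) \<le> L / 2" "d (c t) (c b) \<le> L / 2"
proof -
  obtain w where w: "integrable lborel w" "\<And>x. 0 \<le> w x"
    and dw: "\<And>s t. a \<le> s \<Longrightarrow> s \<le> t \<Longrightarrow> t \<le> b \<Longrightarrow> d (c s) (c t) \<le> (LINT r:{s..t}|lborel. w r)"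
    and len: "curve_length a b d c = ennreal (LINT r:{a..b}|lborel. w r)"
    using ac_curve_length[OF X ab c] by metis
  let ?\<Phi> = "\<lambda>t. LINT r:{..t}|lborel. w r"
  have diff: "?\<Phi> t - ?\<Phi> s = (LINT r:{s..t}|lborel. w r)" if "s \<le> t" for s t
    using that by (rule set_integral_atMost_diff[OF w(1)])
  have le: "(LINT r:{a..b}|lborel. w r) \<le> L" using L len by simp
  have nn: "0 \<le> (LINT r:{a..b}|lborel. w r)"
    using w(2) unfolding set_lebesgue_integral_def by (intro Bochner_Integration.integral_nonneg) auto
  have "\<exists>t\<ge>a. t \<le> b \<and> ?\<Phi> t = (?\<Phi> a + ?\<Phi> b) / 2"
    using ab nn diff[of a b]
    by (intro IVT' set_integral_atMost_continuous w) (auto simp: field_simps)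
  then obtain t where t: "a \<le> t" "t \<le> b" "?\<Phi> t = (?\<Phi> a + ?\<Phi> b) / 2" by blast
  show thesis
  proof (rule that[OF t(1,2)])
    show "d (c a) (c t) \<le> L / 2"
      using dw[of a t] t diff[of a t] diff[of a b] ab le by simp
    show "d (c t) (c b) \<le> L / 2"
      using dw[of t b] t diff[of t b] diff[of a b] ab le by simp
  qed
qed

lemma dist_le_curve_length:
  assumes X: "Metric_space X d" and ab: "a < b" and c: "c \<in> ac_curves a b X d"
  shows "ennreal (d (c a) (c b)) \<le> curve_length a b d c"
proof -
  obtain w where "\<And>s t. a \<le> s \<Longrightarrow> s \<le> t \<Longrightarrow> t \<le> b \<Longrightarrow> d (c s) (c t) \<le> (LINT r:{s..t}|lborel. w r)"
    "curve_length a b d c = ennreal (LINT r:{a..b}|lborel. w r)"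
    using ac_curve_length[OF X ab c] by metis
  then show ?thesis using ab by (simp add: ennreal_leI)
qed

text \<open>
  The metric derivative of a Lipschitz curve exists almost everywhere, so the Lipschitz constant bounds
  the integrand of the length and not merely some upper derivative.
\<close>

lemma Lipschitz_curve_length:
  assumes X: "Metric_space X d" and ab: "a < b" and L: "0 \<le> L"
    and cX: "c \<in> {a..b} \<rightarrow> X"
    and Lip: "\<And>s t. a \<le> s \<Longrightarrow> s \<le> t \<Longrightarrow> t \<le> b \<Longrightarrow> d (c s) (c t) \<le> L * (t - s)"
  shows "c \<in> ac_curves a b X d" "curve_length a b d c \<le> ennreal (L * (b - a))"
proof -
  interpret Metric_space X d by (rule X)
  have "set_integrable lebesgue {a..b} (\<lambda>_. L)"
    unfolding set_integrable_def by (intro integrable_scaleR_left) (use ab in \<open>simp add: integrable_indicator_iff\<close>)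
  moreover have "(LINT r:{s..t}|lebesgue. L) = L * (t - s)" if "s \<le> t" for s t
    using that by (simp add: set_lebesgue_integral_def)
  ultimately show c: "c \<in> ac_curves a b X d"
    unfolding ac_curves_def using cX Lip by (intro CollectI conjI exI[of _ "\<lambda>_. L"] allI impI) simp_all
  obtain w where w: "integrable lborel w" "\<And>x. 0 \<le> w x"
    and lim: "AE t in lborel. a < t \<and> t < b \<longrightarrow> ((\<lambda>s. d (c s) (c t) / \<bar>s - t\<bar>) \<longlongrightarrow> w t) (at t)"
    and len: "curve_length a b d c = ennreal (LINT r:{a..b}|lborel. w r)"
    by (rule ac_curve_length[OF X ab c]) (rule that)
  have "AE t in lborel. ennreal (w t) * indicator {a..b} t \<le> ennreal L * indicator {a..b} t"
    using lim AE_lborel_singleton[of a] AE_lborel_singleton[of b]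
  proof eventually_elim
    case (elim t)
    show ?case
    proof (cases "a < t \<and> t < b")
      case True
      have "\<forall>\<^sub>F s in at t. s \<in> {a<..<b}" using True by (intro eventually_at_in_open') auto
      moreover have "\<forall>\<^sub>F s in at t. s \<noteq> t" by (simp add: eventually_at_filter)
      ultimately have "\<forall>\<^sub>F s in at t. d (c s) (c t) / \<bar>s - t\<bar> \<le> L"
      proof eventually_elim
        case (elim s)
        then have "d (c s) (c t) \<le> L * \<bar>s - t\<bar>"
          using Lip[of s t] Lip[of t s] True commute[of "c t" "c s"] by (cases "s \<le> t") auto
        then show ?case using elim by (simp add: pos_divide_le_eq)
      qed
      then have "w t \<le> L" using elim True by (intro tendsto_upperbound) auto
      then show ?thesis by (intro mult_right_mono ennreal_leI) auto
    next
      case False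
      with elim have "t \<notin> {a..b}" by auto
      then show ?thesis by simp
    qed
  qed
  then have "(\<integral>\<^sup>+t\<in>{a..b}. ennreal (w t) \<partial>lborel) \<le> (\<integral>\<^sup>+t\<in>{a..b}. ennreal L \<partial>lborel)"
    by (rule nn_integral_mono_AE)
  also have "\<dots> = ennreal (L * (b - a))" using ab L by (simp add: nn_integral_cmult_indicator ennreal_mult)
  finally show "curve_length a b d c \<le> ennreal (L * (b - a))"
    using set_nn_integral_eq_ennreal[OF w(1,2), of "{a..b}"] len by simp
qed

text \<open>
  The factor \<open>\<kappa>\<close> treats length spaces (all \<open>\<kappa> > 1\<close>) and geodesic spaces (\<open>\<kappa> = 1\<close>) alike.
\<close>

definition has_midpoints :: "real \<Rightarrow> 'x set \<Rightarrow> ('x \<Rightarrow> 'x \<Rightarrow> real) \<Rightarrow> bool" where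
  "has_midpoints \<kappa> X d \<longleftrightarrow>
    (\<forall>x\<in>X. \<forall>y\<in>X. \<exists>z\<in>X. d x z \<le> \<kappa> / 2 * d x y \<and> d z y \<le> \<kappa> / 2 * d x y)"

definition has_Lipschitz_paths :: "real \<Rightarrow> 'x set \<Rightarrow> ('x \<Rightarrow> 'x \<Rightarrow> real) \<Rightarrow> bool" where
  "has_Lipschitz_paths \<kappa> X d \<longleftrightarrow>
    (\<forall>x\<in>X. \<forall>y\<in>X. \<exists>\<gamma>. \<gamma> \<in> {0..1} \<rightarrow> X \<and> \<gamma> 0 = x \<and> \<gamma> 1 = y \<and>
      (\<forall>s t. 0 \<le> s \<longrightarrow> s \<le> t \<longrightarrow> t \<le> 1 \<longrightarrow> d (\<gamma> s) (\<gamma> t) \<le> \<kappa> * d x y * (t - s)))"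

lemma geodesic_space_imp_midpoints:
  assumes X: "Metric_space X d" and ab: "a < b" and geo: "geodesic_space a b X d"
  shows "has_midpoints 1 X d"
  unfolding has_midpoints_def
proof (intro ballI)
  interpret Metric_space X d by (rule X)
  fix x y assume xy: "x \<in> X" "y \<in> X"
  then obtain c where c: "c \<in> ac_curves a b X d" "c a = x" "c b = y" "curve_length a b d c = ennreal (d x y)"
    using geo by (auto simp: geodesic_space_def)
  obtain t where "a \<le> t" "t \<le> b" "d (c a) (c t) \<le> d x y / 2" "d (c t) (c b) \<le> d x y / 2"
    using ac_curve_halfway_point[OF X ab c(1), of "d x y"] c by auto
  with c show "\<exists>z\<in>X. d x z \<le> 1 / 2 * d x y \<and> d z y \<le> 1 / 2 * d x y"
    by (intro bexI[of _ "c t"]) (auto simp: ac_curves_def)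
qed

lemma length_space_imp_midpoints:
  assumes X: "Metric_space X d" and ab: "a < b" and len: "length_space a b X d" and \<kappa>: "1 < \<kappa>"
  shows "has_midpoints \<kappa> X d"
  unfolding has_midpoints_def
proof (intro ballI)
  interpret Metric_space X d by (rule X)
  fix x y assume xy: "x \<in> X" "y \<in> X"
  show "\<exists>z\<in>X. d x z \<le> \<kappa> / 2 * d x y \<and> d z y \<le> \<kappa> / 2 * d x y"
  proof (cases "x = y")
    case True
    with xy show ?thesis by (intro bexI[of _ x]) auto
  next
    case False
    then have pos: "0 < d x y" using xy by (metis mdist_pos_eq)
    then have "d x y < \<kappa> * d x y" using \<kappa> by simp
    then have "intrinsic_dist a b X d x y < ennreal (\<kappa> * d x y)"
      using len xy pos \<kappa> unfolding length_space_def by (metis ennreal_lessI mult_pos_pos zero_less_one order.strict_trans)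
    then obtain c where c: "c \<in> ac_curves a b X d" "c a = x" "c b = y" "curve_length a b d c < ennreal (\<kappa> * d x y)"
      unfolding intrinsic_dist_def by (auto simp: Inf_less_iff)
    obtain t where "a \<le> t" "t \<le> b" "d (c a) (c t) \<le> \<kappa> * d x y / 2" "d (c t) (c b) \<le> \<kappa> * d x y / 2"
    proof (rule ac_curve_halfway_point[OF X ab c(1) less_imp_le[OF c(4)]])
      show "0 \<le> \<kappa> * d x y" using \<kappa> pos by simp
    qed
    with c show ?thesis
      by (intro bexI[of _ "c t"]) (auto simp: ac_curves_def)
  qed
qed

lemma Lipschitz_paths_imp_ac_curve:
  assumes X: "Metric_space X d" and ab: "a < b" and lip: "has_Lipschitz_paths \<kappa> X d" and \<kappa>: "0 \<le> \<kappa>"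
    and xy: "x \<in> X" "y \<in> X"
  obtains c where "c \<in> ac_curves a b X d" "c a = x" "c b = y" "curve_length a b d c \<le> ennreal (\<kappa> * d x y)"
proof -
  interpret Metric_space X d by (rule X)
  obtain \<gamma> where \<gamma>: "\<gamma> \<in> {0..1} \<rightarrow> X" "\<gamma> 0 = x" "\<gamma> 1 = y"
    "\<And>s t. 0 \<le> s \<Longrightarrow> s \<le> t \<Longrightarrow> t \<le> 1 \<Longrightarrow> d (\<gamma> s) (\<gamma> t) \<le> \<kappa> * d x y * (t - s)"
    using lip xy unfolding has_Lipschitz_paths_def by metis
  define c where "c = (\<lambda>t. \<gamma> ((t - a) / (b - a)))"
  define L where "L = \<kappa> * d x y / (b - a)"
  have L: "0 \<le> L" using \<kappa> ab by (simp add: L_def)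
  have cX: "c \<in> {a..b} \<rightarrow> X"
  proof
    fix t assume "t \<in> {a..b}"
    then have "(t - a) / (b - a) \<in> {0..1}" using ab by (simp add: field_simps)
    with \<gamma>(1) show "c t \<in> X" unfolding c_def by blast
  qed
  have Lip: "d (c s) (c t) \<le> L * (t - s)" if "a \<le> s" "s \<le> t" "t \<le> b" for s t
  proof -
    have "d (c s) (c t) \<le> \<kappa> * d x y * ((t - a) / (b - a) - (s - a) / (b - a))"
      unfolding c_def using that ab by (intro \<gamma>(4)) (auto simp: divide_right_mono)
    also have "\<dots> = L * (t - s)" using ab by (simp add: L_def diff_divide_distrib[symmetric])
    finally show ?thesis .
  qed
  have "L * (b - a) = \<kappa> * d x y" using ab by (simp add: L_def)
  then show thesis
    using that[of c] Lipschitz_curve_length[OF X ab L cX Lip] \<gamma> ab by (simp add: c_def)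
qed

lemma Lipschitz_paths_imp_geodesic_space:
  assumes X: "Metric_space X d" and ab: "a < b" and lip: "has_Lipschitz_paths 1 X d"
  shows "geodesic_space a b X d"
  unfolding geodesic_space_def
proof (intro ballI)
  fix x y assume xy: "x \<in> X" "y \<in> X"
  obtain c where c: "c \<in> ac_curves a b X d" "c a = x" "c b = y" "curve_length a b d c \<le> ennreal (d x y)"
  proof (rule Lipschitz_paths_imp_ac_curve[OF X ab lip _ xy])
    fix c assume "c \<in> ac_curves a b X d" "c a = x" "c b = y" "curve_length a b d c \<le> ennreal (1 * d x y)"
    then show thesis using that by simp
  qed simp
  have "curve_length a b d c = ennreal (d x y)"
    using dist_le_curve_length[OF X ab c(1)] c by (intro antisym) simp_all
  with c show "\<exists>c\<in>ac_curves a b X d. c a = x \<and> c b = y \<and> curve_length a b d c = ennreal (d x y)"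
    by blast
qed

lemma Lipschitz_paths_imp_length_space:
  assumes X: "Metric_space X d" and ab: "a < b" and lip: "\<And>\<kappa>. 1 < \<kappa> \<Longrightarrow> has_Lipschitz_paths \<kappa> X d"
  shows "length_space a b X d"
  unfolding length_space_def
proof (intro ballI antisym)
  interpret Metric_space X d by (rule X)
  fix x y assume xy: "x \<in> X" "y \<in> X"
  show "ennreal (d x y) \<le> intrinsic_dist a b X d x y"
    unfolding intrinsic_dist_def
  proof (rule Inf_greatest)
    fix l assume "l \<in> {curve_length a b d c |c. c \<in> ac_curves a b X d \<and> c a = x \<and> c b = y}"
    then obtain c where c: "l = curve_length a b d c" "c \<in> ac_curves a b X d" "c a = x" "c b = y" by blast
    with dist_le_curve_length[OF X ab c(2)] show "ennreal (d x y) \<le> l" by simp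
  qed
  show "intrinsic_dist a b X d x y \<le> ennreal (d x y)"
  proof (rule ennreal_le_epsilon)
    fix e :: real assume e: "0 < e"
    define \<kappa> where "\<kappa> = 1 + e / (1 + d x y)"
    have \<kappa>: "1 < \<kappa>" using e by (simp add: \<kappa>_def add_pos_nonneg)
    obtain c where c: "c \<in> ac_curves a b X d" "c a = x" "c b = y" "curve_length a b d c \<le> ennreal (\<kappa> * d x y)"
      by (rule Lipschitz_paths_imp_ac_curve[OF X ab lip[OF \<kappa>] _ xy]) (use \<kappa> in simp)
    have "d x y / (1 + d x y) \<le> 1" by (simp add: divide_le_eq_1 add_pos_nonneg)
    then have "e * (d x y / (1 + d x y)) \<le> e" using e mult_left_mono[of _ 1 e] by fastforce
    then have le: "\<kappa> * d x y \<le> d x y + e" by (simp add: \<kappa>_def distrib_right)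
    have "intrinsic_dist a b X d x y \<le> curve_length a b d c"
      unfolding intrinsic_dist_def using c by (intro Inf_lower) auto
    also have "\<dots> \<le> ennreal (d x y + e)" using c(4) le by (meson ennreal_leI order_trans)
    also have "\<dots> = ennreal (d x y) + ennreal e" using e by simp
    finally show "intrinsic_dist a b X d x y \<le> ennreal (d x y) + ennreal e" .
  qed
qed

section \<open>Lipschitz paths from dyadic midpoints\<close>

text \<open>
  The value at time \<open>k / 2 ^ n\<close> after \<open>n\<close> rounds of inserting midpoints between neighbours. Past time
  \<open>1\<close> the values at level \<open>0\<close> are constantly \<open>y\<close>, which spares all later statements a bound on \<open>k\<close>.
  The values are of an arbitrary type, so that points of a space and maps into it are covered at once.
\<close>

fun dyadic_refine :: "(nat \<Rightarrow> 'v \<Rightarrow> 'v \<Rightarrow> 'v) \<Rightarrow> 'v \<Rightarrow> 'v \<Rightarrow> nat \<Rightarrow> nat \<Rightarrow> 'v" where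
  "dyadic_refine mid x y 0 k = (if k = 0 then x else y)"
| "dyadic_refine mid x y (Suc n) k =
    (if even k then dyadic_refine mid x y n (k div 2)
     else mid n (dyadic_refine mid x y n (k div 2)) (dyadic_refine mid x y n (k div 2 + 1)))"

lemma dyadic_refine_0 [simp]: "dyadic_refine mid x y n 0 = x"
  by (induction n) auto

lemma dyadic_refine_end [simp]: "dyadic_refine mid x y n (2 ^ n) = y"
  by (induction n) auto

text \<open>
  The relative error allowed in each round: the exponents \<open>1 / 2, 1 / 4, \<dots>\<close> add up to at most \<open>1\<close>, so
  that for \<open>\<kappa> \<ge> 1\<close> all rounds together cost a factor of at most \<open>\<kappa>\<close>. For \<open>\<kappa> = 1\<close> every round is exact.
\<close>

definition refine_factor :: "real \<Rightarrow> nat \<Rightarrow> real" where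
  "refine_factor \<kappa> n = \<kappa> powr (1 / 2 ^ Suc n)"

lemma refine_factor_1 [simp]: "refine_factor 1 n = 1"
  by (simp add: refine_factor_def)

lemma refine_factor_gt_1: "1 < \<kappa> \<Longrightarrow> 1 < refine_factor \<kappa> n"
  by (simp add: refine_factor_def gr_one_powr)

lemma prod_refine_factor:
  assumes "1 \<le> \<kappa>"
  shows "(\<Prod>i<n. refine_factor \<kappa> i) \<le> \<kappa>"
proof -
  have "(\<Prod>i<n. refine_factor \<kappa> i) = \<kappa> powr (1 - 1 / 2 ^ n)"
  proof (induction n)
    case 0
    then show ?case using assms by simp
  next
    case (Suc n)
    have "(\<Prod>i<Suc n. refine_factor \<kappa> i) = \<kappa> powr (1 - 1 / 2 ^ n) * \<kappa> powr (1 / 2 ^ Suc n)"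
      using Suc by (simp add: refine_factor_def)
    also have "\<dots> = \<kappa> powr ((1 - 1 / 2 ^ n) + 1 / 2 ^ Suc n)" by (rule powr_add[symmetric])
    also have "(1 - 1 / 2 ^ n) + 1 / 2 ^ Suc n = (1 - 1 / 2 ^ Suc n :: real)" by (simp add: field_simps)
    finally show ?case .
  qed
  also have "\<dots> \<le> \<kappa> powr 1" using assms by (intro powr_mono) auto
  finally show ?thesis using assms by simp
qed

lemma dyadic_refine_step:
  fixes G :: "nat \<Rightarrow> nat \<Rightarrow> 'n::metric_space"
  assumes \<kappa>: "1 \<le> \<kappa>"
    and start: "\<And>k. dist (G 0 k) (G 0 (Suc k)) \<le> D"
    and even: "\<And>n k. G (Suc n) (2 * k) = G n k"
    and mid: "\<And>n k. dist (G n k) (G (Suc n) (2 * k + 1)) \<le> refine_factor \<kappa> n / 2 * dist (G n k) (G n (Suc k))"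
      "\<And>n k. dist (G (Suc n) (2 * k + 1)) (G n (Suc k)) \<le> refine_factor \<kappa> n / 2 * dist (G n k) (G n (Suc k))"
  shows "dist (G n k) (G n (Suc k)) \<le> \<kappa> * D / 2 ^ n"
proof -
  have D: "0 \<le> D" using start[of 0] zero_le_dist order_trans by blast
  have rf: "0 \<le> refine_factor \<kappa> n" for n by (simp add: refine_factor_def)
  have "dist (G n k) (G n (Suc k)) \<le> (\<Prod>i<n. refine_factor \<kappa> i) * D / 2 ^ n"
  proof (induction n arbitrary: k)
    case 0
    then show ?case using start by simp
  next
    case (Suc n)
    let ?j = "k div 2"
    have "dist (G (Suc n) k) (G (Suc n) (Suc k)) \<le> refine_factor \<kappa> n / 2 * dist (G n ?j) (G n (Suc ?j))"
    proof (cases "Parity.even k")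
      case True
      then obtain j where "k = 2 * j" by (elim evenE)
      then show ?thesis using mid(1)[of n j] even[of n j] by simp
    next
      case False
      then obtain j where "k = 2 * j + 1" by (elim oddE)
      then show ?thesis using mid(2)[where n=n and k=j] even[of n "Suc j"] by simp
    qed
    also have "\<dots> \<le> refine_factor \<kappa> n / 2 * ((\<Prod>i<n. refine_factor \<kappa> i) * D / 2 ^ n)"
      using Suc.IH[of ?j] rf by (intro mult_left_mono) auto
    also have "\<dots> = (\<Prod>i<Suc n. refine_factor \<kappa> i) * D / 2 ^ Suc n" by simp
    finally show ?case .
  qed
  also have "\<dots> \<le> \<kappa> * D / 2 ^ n"
    using prod_refine_factor[OF \<kappa>] D by (intro divide_right_mono mult_right_mono) auto
  finally show ?thesis .
qed

text \<open>
  At a fixed time \<open>t\<close> the approximations from below by dyadic times of level \<open>n\<close> move by at most one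
  step when \<open>n\<close> grows by one, so they form a Cauchy sequence. The Lipschitz bound holds along dyadic times
  up to an error \<open>C / 2 ^ n\<close> from rounding and passes to the limit.
\<close>

lemma dyadic_limit_path:
  fixes G :: "nat \<Rightarrow> nat \<Rightarrow> 'n::complete_space"
  assumes even: "\<And>n k. G (Suc n) (2 * k) = G n k"
    and step: "\<And>n k. dist (G n k) (G n (Suc k)) \<le> C / 2 ^ n"
  obtains \<gamma> where "\<And>t. 0 \<le> t \<Longrightarrow> (\<lambda>n. G n (nat \<lfloor>2 ^ n * t\<rfloor>)) \<longlonglongrightarrow> \<gamma> t"
    "\<And>s t. 0 \<le> s \<Longrightarrow> s \<le> t \<Longrightarrow> dist (\<gamma> s) (\<gamma> t) \<le> C * (t - s)"
proof -
  define i where "i = (\<lambda>(t::real) n. nat \<lfloor>2 ^ n * t\<rfloor>)"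
  have C: "0 \<le> C" using step[of 0 0] zero_le_dist[of "G 0 0" "G 0 1"] by (simp del: zero_le_dist)
  have i_le: "real (i t n) \<le> 2 ^ n * t" and i_gt: "2 ^ n * t < real (i t n) + 1" if "0 \<le> t" for t n
    using that by (simp_all add: i_def) 
  \<comment> \<open>rounding down at level \<open>Suc n\<close> yields the same dyadic number as at level \<open>n\<close>, or its successor\<close>
  have i_Suc: "i t (Suc n) = 2 * i t n \<or> i t (Suc n) = 2 * i t n + 1" if t: "0 \<le> t" for t n
  proof -
    have "real (i t (Suc n)) < real (2 * i t n + 2)" "real (2 * i t n) < real (i t (Suc n) + 1)"
      using i_le[OF t, of n] i_gt[OF t, of n] i_le[OF t, of "Suc n"] i_gt[OF t, of "Suc n"] by simp_all
    then show ?thesis by linarith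
  qed
  have chain: "dist (G n j) (G n (j + l)) \<le> C * l / 2 ^ n" for n j l
  proof (induction l)
    case (Suc l)
    have "dist (G n j) (G n (j + Suc l)) \<le> dist (G n j) (G n (j + l)) + dist (G n (j + l)) (G n (Suc (j + l)))"
      using dist_triangle by simp
    also have "\<dots> \<le> C * l / 2 ^ n + C / 2 ^ n" using Suc step by (intro add_mono) auto
    finally show ?case by (simp add: field_simps)
  qed simp
  have next_le: "dist (G n (i t n)) (G (Suc n) (i t (Suc n))) \<le> C * (1/2) ^ Suc n" if "0 \<le> t" for t n
    using i_Suc[OF that, of n] step[of "Suc n" "2 * i t n"] C
    by (auto simp: even power_divide)
  have conv: "convergent (\<lambda>n. G n (i t n))" if t: "0 \<le> t" for t
  proof -
    have tail: "dist (G n (i t n)) (G (n + k) (i t (n + k))) \<le> C * (1/2)^n * (1 - (1/2)^k)" for n k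
    proof (induction k)
      case (Suc k)
      have "dist (G n (i t n)) (G (n + Suc k) (i t (n + Suc k)))
        \<le> dist (G n (i t n)) (G (n + k) (i t (n + k))) + dist (G (n + k) (i t (n + k))) (G (Suc (n + k)) (i t (Suc (n + k))))"
        using dist_triangle by simp
      also have "\<dots> \<le> C * (1/2)^n * (1 - (1/2)^k) + C * (1/2) ^ Suc (n + k)"
        using Suc next_le[OF t, of "n + k"] by (intro add_mono) auto
      also have "\<dots> = C * (1/2)^n * (1 - (1/2)^Suc k)" by (simp add: power_add algebra_simps)
      finally show ?case .
    qed simp
    have "Cauchy (\<lambda>n. G n (i t n))"
    proof (rule metric_CauchyI)
      fix e :: real assume e: "0 < e"
      have "(\<lambda>n. C * (1/2)^n) \<longlonglongrightarrow> C * 0" by (intro tendsto_mult_left LIMSEQ_power_zero) simp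
      from order_tendstoD(2)[OF this, of "e / 2"] e have "\<forall>\<^sub>F n in sequentially. C * (1/2)^n < e / 2" by simp
      then have "\<exists>N. C * (1/2)^N < e / 2" using eventually_happens' sequentially_bot by blast
      then obtain N where N: "C * (1/2)^N < e / 2" by (rule exE)
      have near: "dist (G N (i t N)) (G m (i t m)) < e / 2" if "N \<le> m" for m
      proof -
        from le_Suc_ex[OF that] obtain k where m: "m = N + k" by (rule exE)
        have "C * (1/2)^N * (1 - (1/2)^k) \<le> C * (1/2)^N"
          by (rule mult_left_le) (simp, rule mult_nonneg_nonneg, rule C, simp)
        with tail[of N k] N show ?thesis unfolding m by linarith
      qed
      have "dist (G m (i t m)) (G n (i t n)) < e" if "N \<le> m" "N \<le> n" for m n
        using near[OF that(1)] near[OF that(2)] dist_triangle3[of "G m (i t m)" "G n (i t n)" "G N (i t N)"] by simp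
      then show "\<exists>M. \<forall>m\<ge>M. \<forall>n\<ge>M. dist (G m (i t m)) (G n (i t n)) < e" by blast
    qed
    then show ?thesis by (rule Cauchy_convergent)
  qed
  define \<gamma> where "\<gamma> = (\<lambda>t. lim (\<lambda>n. G n (i t n)))"
  have lim: "(\<lambda>n. G n (i t n)) \<longlonglongrightarrow> \<gamma> t" if "0 \<le> t" for t
    using conv[OF that] by (simp add: \<gamma>_def convergent_LIMSEQ_iff)
  have "dist (\<gamma> s) (\<gamma> t) \<le> C * (t - s)" if st: "0 \<le> s" "s \<le> t" for s t
  proof -
    have t: "0 \<le> t" using st by simp
    have lim1: "(\<lambda>n. dist (G n (i s n)) (G n (i t n))) \<longlonglongrightarrow> dist (\<gamma> s) (\<gamma> t)"
      using lim[OF st(1)] lim[OF t] by (rule tendsto_dist)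
    have "(\<lambda>n. C * (t - s) + C * (1/2)^n) \<longlonglongrightarrow> C * (t - s) + C * 0"
      by (intro tendsto_add tendsto_const tendsto_mult_left LIMSEQ_power_zero) simp
    then have lim2: "(\<lambda>n. C * (t - s) + C * (1/2)^n) \<longlonglongrightarrow> C * (t - s)" by simp
    have "dist (G n (i s n)) (G n (i t n)) \<le> C * (t - s) + C * (1/2)^n" for n
    proof -
      have "i s n \<le> i t n" unfolding i_def using st by (intro nat_mono floor_mono mult_left_mono) auto
      from le_Suc_ex[OF this] obtain l where l: "i t n = i s n + l" by (rule exE)
      have "real l \<le> 2 ^ n * (t - s) + 1"
        using i_le[OF t, of n] i_gt[OF st(1), of n] l by (simp add: algebra_simps)
      then have "C * real l / 2 ^ n \<le> C * (2 ^ n * (t - s) + 1) / 2 ^ n"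
        using C by (intro divide_right_mono mult_left_mono) auto
      also have "\<dots> = C * (t - s) + C * (1/2)^n" by (simp add: field_simps power_divide)
      finally show ?thesis using chain[of n "i s n" l] l by simp
    qed
    then show ?thesis using LIMSEQ_le[OF lim1 lim2] by simp
  qed
  then show thesis using that[of \<gamma>] lim by (simp add: i_def)
qed

lemma has_midpoints_imp_Lipschitz_paths:
  assumes \<kappa>: "1 \<le> \<kappa>" and mid: "\<And>n. has_midpoints (refine_factor \<kappa> n) (UNIV :: 'n::complete_space set) dist"
  shows "has_Lipschitz_paths \<kappa> (UNIV :: 'n set) dist"
  unfolding has_Lipschitz_paths_def
proof (intro ballI)
  fix x y :: 'n
  have "\<exists>z. dist x z \<le> refine_factor \<kappa> n / 2 * dist x y \<and> dist z y \<le> refine_factor \<kappa> n / 2 * dist x y" for n and x y :: 'n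
    using mid[of n] by (simp add: has_midpoints_def)
  then have "\<exists>M. \<forall>n (x::'n) y. dist x (M n x y) \<le> refine_factor \<kappa> n / 2 * dist x y
      \<and> dist (M n x y) y \<le> refine_factor \<kappa> n / 2 * dist x y"
    by (intro choice allI)
  then obtain M where M: "\<And>n (x::'n) y. dist x (M n x y) \<le> refine_factor \<kappa> n / 2 * dist x y"
    "\<And>n (x::'n) y. dist (M n x y) y \<le> refine_factor \<kappa> n / 2 * dist x y" by blast
  define G where "G = dyadic_refine M x y"
  have even: "G (Suc n) (2 * k) = G n k" for n k by (simp add: G_def)
  have odd: "G (Suc n) (2 * k + 1) = M n (G n k) (G n (Suc k))" for n k by (simp add: G_def)
  have step: "dist (G n k) (G n (Suc k)) \<le> \<kappa> * dist x y / 2 ^ n" for n k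
  proof (rule dyadic_refine_step[of _ G, OF \<kappa> _ even])
    show "dist (G 0 k) (G 0 (Suc k)) \<le> dist x y" for k by (simp add: G_def)
  qed (unfold odd, rule M, rule M)
  obtain \<gamma> where \<gamma>: "\<And>t. 0 \<le> t \<Longrightarrow> (\<lambda>n. G n (nat \<lfloor>2 ^ n * t\<rfloor>)) \<longlonglongrightarrow> \<gamma> t"
    and lip: "\<And>s t. 0 \<le> s \<Longrightarrow> s \<le> t \<Longrightarrow> dist (\<gamma> s) (\<gamma> t) \<le> \<kappa> * dist x y * (t - s)"
    using dyadic_limit_path[of G, OF even step] by blast
  have "\<gamma> 0 = x" using \<gamma>[of 0] by (simp add: G_def LIMSEQ_const_iff)
  moreover have "\<gamma> 1 = y"
  proof -
    show ?thesis using \<gamma>[of 1] by (simp add: G_def LIMSEQ_const_iff nat_power_eq)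
  qed
  ultimately show "\<exists>\<gamma>. \<gamma> \<in> {0..1} \<rightarrow> UNIV \<and> \<gamma> 0 = x \<and> \<gamma> 1 = y \<and>
      (\<forall>s t. 0 \<le> s \<longrightarrow> s \<le> t \<longrightarrow> t \<le> 1 \<longrightarrow> dist (\<gamma> s) (\<gamma> t) \<le> \<kappa> * dist x y * (t - s))"
    using lip by (intro exI[of _ \<gamma>]) auto
qed

section \<open>Measurable selection almost everywhere\<close>

text \<open>
  The projection to the first factor of the part of \<open>P\<close> that lies above \<open>A\<close> in the second.
\<close>

definition meets :: "('x \<times> 'z) set \<Rightarrow> 'z set \<Rightarrow> 'x set" where
  "meets P A = {y. \<exists>z\<in>A. (y, z) \<in> P}"

lemma closed_meets_compact:
  fixes P :: "('x::metric_space \<times> 'z::metric_space) set"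
  assumes P: "closed P" and K: "compact K"
  shows "closed (meets P K)"
  unfolding closed_sequential_limits
proof (intro allI impI)
  fix y l assume *: "(\<forall>n. y n \<in> meets P K) \<and> y \<longlonglongrightarrow> l"
  then have "\<forall>n. \<exists>z. z \<in> K \<and> (y n, z) \<in> P" by (auto simp: meets_def)
  then obtain z where z: "\<And>n. z n \<in> K" "\<And>n. (y n, z n) \<in> P" by metis
  obtain w r where w: "w \<in> K" "strict_mono (r :: nat \<Rightarrow> nat)" "(z \<circ> r) \<longlonglongrightarrow> w"
    using K z(1) unfolding compact_def by metis
  have "(y \<circ> r) \<longlonglongrightarrow> l" using * w(2) by (intro LIMSEQ_subseq_LIMSEQ) auto
  then have "(\<lambda>n. ((y \<circ> r) n, (z \<circ> r) n)) \<longlonglongrightarrow> (l, w)" using w(3) by (rule tendsto_Pair)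
  moreover have "((y \<circ> r) n, (z \<circ> r) n) \<in> P" for n using z(2) by simp
    ultimately have "(l, w) \<in> P" by (rule closed_sequentially[OF P, rotated])
  then show "l \<in> meets P K" using w(1) by (auto simp: meets_def)
qed

text \<open>
  Total boundedness in sequential form. The sequence itself need not lie in the intersection of the
  covers; only its limit points do.
\<close>

lemma subseq_limit_in_nested_covers:
  fixes z q :: "nat \<Rightarrow> 'z::complete_space"
  assumes z: "\<And>m n. m < n \<Longrightarrow> z n \<in> (\<Union>i\<le>N m. cball (q i) (1 / 2 ^ m))"
  obtains r l where "strict_mono (r :: nat \<Rightarrow> nat)" "(z \<circ> r) \<longlonglongrightarrow> l"
    "\<And>m. l \<in> (\<Union>i\<le>N m. cball (q i) (1 / 2 ^ m))"
proof -
  have "compact (closure (range z))"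
    unfolding compact_eq_totally_bounded
  proof (intro conjI allI impI)
    show "complete (closure (range z))" by (simp add: complete_eq_closed)
    fix e :: real assume "0 < e"
    then obtain m where m: "(1 / 2) ^ m < e" using real_arch_pow_inv[of e "1 / 2"] by auto
    let ?F = "z ` {..m} \<union> q ` {..N m}"
    have in_cover: "z n \<in> (\<Union>x\<in>?F. cball x (1 / 2 ^ m))" for n
    proof (cases "m < n")
      case True
      with z[OF True] show ?thesis by blast
    next
      case False
      then show ?thesis by (intro UN_I[of "z n"]) auto
    qed
    have "closure (range z) \<subseteq> (\<Union>x\<in>?F. cball x (1 / 2 ^ m))"
    proof (rule closure_minimal)
      show "range z \<subseteq> (\<Union>x\<in>?F. cball x (1 / 2 ^ m))" using in_cover by blast
    qed (intro closed_UN; simp)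
    also have "\<dots> \<subseteq> (\<Union>x\<in>?F. ball x e)" using m by (intro UN_mono) (auto simp: power_divide)
    finally show "\<exists>k. finite k \<and> closure (range z) \<subseteq> (\<Union>x\<in>k. ball x e)" by (intro exI[of _ ?F]) auto
  qed
  moreover have "\<forall>n. z n \<in> closure (range z)" using closure_subset by fastforce
  ultimately obtain l r where r: "strict_mono (r :: nat \<Rightarrow> nat)" and l: "(z \<circ> r) \<longlonglongrightarrow> l"
    unfolding compact_def by metis
  have "l \<in> (\<Union>i\<le>N m. cball (q i) (1 / 2 ^ m))" for m
  proof (rule Lim_in_closed_set[OF _ _ _ l])
    show "closed (\<Union>i\<le>N m. cball (q i) (1 / 2 ^ m))" by (intro closed_UN) auto
    show "\<forall>\<^sub>F n in sequentially. (z \<circ> r) n \<in> (\<Union>i\<le>N m. cball (q i) (1 / 2 ^ m))"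
      unfolding eventually_sequentially
    proof (intro exI[of _ "Suc m"] allI impI)
      fix n assume "Suc m \<le> n"
      then have "m < r n" using seq_suble[OF r, of n] by linarith
      then show "(z \<circ> r) n \<in> (\<Union>i\<le>N m. cball (q i) (1 / 2 ^ m))" using z by simp
    qed
  qed simp
  with r l show thesis by (rule that)
qed

lemma dense_sequence:
  obtains q :: "nat \<Rightarrow> 'z::{metric_space, second_countable_topology}" where
    "\<And>z e. 0 < e \<Longrightarrow> \<exists>i. dist (q i) z < e"
proof -
  obtain D :: "'z set" where D: "countable D" "\<And>X. open X \<Longrightarrow> X \<noteq> {} \<Longrightarrow> \<exists>d\<in>D. d \<in> X"
    using countable_dense_setE by blast
  then have "D \<noteq> {}" using D(2)[of UNIV] by auto
  show thesis
  proof (rule that[of "from_nat_into D"])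
    fix z :: 'z and e :: real assume "0 < e"
    then obtain d where "d \<in> D" "d \<in> ball z e" using D(2)[of "ball z e"] by auto
    then show "\<exists>i. dist (from_nat_into D i) z < e"
      using from_nat_into_surj[OF D(1)] by (metis dist_commute mem_ball)
  qed
qed

text \<open>
  The image of \<open>P\<close> under projection is analytic in general, and this is the capacity argument for
  analytic sets. Outer measure is continuous along increasing unions, so at each scale finitely many
  balls of radius \<open>1 / 2 ^ n\<close> can be kept such that the points whose fibre meets what is kept still have
  outer measure above \<open>c\<close>. The intersection \<open>K\<close> of these finite unions of balls is compact. A point that
  is a limit, at every scale, of points whose fibre meets the kept set has a fibre that meets \<open>K\<close>; so
  closures, which are measurable, can replace the sets of unknown measurability.
\<close>

lemma compact_meets_large_measure:
  fixes P :: "('x::metric_space \<times> 'z::polish_space) set" and \<phi> :: "'m \<Rightarrow> 'x"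
  assumes M: "finite_measure M" and \<phi>: "\<phi> \<in> borel_measurable M" and P: "closed P"
    and fib: "\<And>x. x \<in> space M \<Longrightarrow> \<exists>z. (\<phi> x, z) \<in> P"
    and c: "c < emeasure M (space M)"
  obtains K where "compact K" "c \<le> emeasure M (\<phi> -` meets P K \<inter> space M)"
proof -
  interpret finite_measure M by (rule M)
  note [measurable] = \<phi>
  let ?S = "\<lambda>A. \<phi> -` meets P A \<inter> space M"
  obtain q :: "nat \<Rightarrow> 'z" where q: "\<And>z e. 0 < e \<Longrightarrow> \<exists>i. dist (q i) z < e" using dense_sequence by blast
  \<comment> \<open>\<open>A n\<close> is the part kept after \<open>n\<close> scales\<close>
  have "\<exists>A. \<forall>n. c < outer_measure_of M (?S (A n)) \<and>
      (A (Suc n) \<subseteq> A n \<and> (\<exists>N. A (Suc n) \<subseteq> (\<Union>i\<le>N. cball (q i) (1 / 2 ^ n))))"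
  proof (rule dependent_nat_choice)
    have "?S UNIV = space M" using fib by (auto simp: meets_def)
    then show "\<exists>A. c < outer_measure_of M (?S A)" using c by (metis outer_measure_of_eq sets.top)
  next
    fix A :: "'z set" and n :: nat
    assume c_less: "c < outer_measure_of M (?S A)"
    let ?B = "\<lambda>N. A \<inter> (\<Union>i\<le>N. cball (q i) (1 / 2 ^ n))"
    have "A \<subseteq> (\<Union>N. ?B N)"
    proof
      fix z assume "z \<in> A"
      moreover obtain i where "dist (q i) z < 1 / 2 ^ n" using q[of "1 / 2 ^ n" z] by auto
      ultimately show "z \<in> (\<Union>N. ?B N)" by (force intro: less_imp_le)
    qed
    then have "?S A = (\<Union>N. ?S (?B N))" by (auto simp: meets_def) blast
    moreover have "incseq (\<lambda>N. ?S (?B N))"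
      by (rule incseq_SucI) (force simp: meets_def)
    ultimately have "(SUP N. outer_measure_of M (?S (?B N))) = outer_measure_of M (?S A)"
      using SUP_outer_measure_of_incseq[of "\<lambda>N. ?S (?B N)" M] by simp
    with c_less obtain N where "c < outer_measure_of M (?S (?B N))" by (metis (mono_tags, lifting) less_SUP_iff)
    then show "\<exists>B. c < outer_measure_of M (?S B) \<and> B \<subseteq> A \<and> (\<exists>N. B \<subseteq> (\<Union>i\<le>N. cball (q i) (1 / 2 ^ n)))"
      by blast
  qed
  then obtain A where A: "\<And>n. c < outer_measure_of M (?S (A n))" "\<And>n. A (Suc n) \<subseteq> A n"
    "\<And>n. \<exists>N. A (Suc n) \<subseteq> (\<Union>i\<le>N. cball (q i) (1 / 2 ^ n))" by blast
  then obtain N where N: "\<And>n. A (Suc n) \<subseteq> (\<Union>i\<le>N n. cball (q i) (1 / 2 ^ n))" by metis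
  have decA: "m \<le> n \<Longrightarrow> A n \<subseteq> A m" for m n by (rule lift_Suc_antimono_le[of A]) (use A in auto)
  define K where "K = (\<Inter>m. \<Union>i\<le>N m. cball (q i) (1 / 2 ^ m))"
  have K: "compact K"
    unfolding compact_def
  proof (intro allI impI)
    fix z :: "nat \<Rightarrow> 'z" assume "\<forall>n. z n \<in> K"
    then have "z n \<in> (\<Union>i\<le>N m. cball (q i) (1 / 2 ^ m))" for m n unfolding K_def by blast
    then obtain l r where "strict_mono (r :: nat \<Rightarrow> nat)" "(z \<circ> r) \<longlonglongrightarrow> l"
      "\<And>m. l \<in> (\<Union>i\<le>N m. cball (q i) (1 / 2 ^ m))"
      by (rule subseq_limit_in_nested_covers[where z = z and N = N and q = q]) (rule that)
    then show "\<exists>l\<in>K. \<exists>r. strict_mono (r :: nat \<Rightarrow> nat) \<and> (z \<circ> r) \<longlonglongrightarrow> l" unfolding K_def by blast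
  qed
  have sub: "(\<Inter>n. closure (meets P (A n))) \<subseteq> meets P K"
  proof
    fix y assume y: "y \<in> (\<Inter>n. closure (meets P (A n)))"
    have "\<exists>p z. dist p y < 1 / 2 ^ n \<and> z \<in> A n \<and> (p, z) \<in> P" for n
    proof -
      from y have "y \<in> closure (meets P (A n))" by blast
      then obtain p where "p \<in> meets P (A n)" "dist p y < 1 / 2 ^ n"
        unfolding closure_approachable by (metis half_gt_zero_iff zero_less_divide_1_iff zero_less_numeral zero_less_power)
      then show ?thesis by (auto simp: meets_def)
    qed
    then obtain p z where p: "\<And>n. dist (p n) y < 1 / 2 ^ n" and z: "\<And>n. z n \<in> A n" "\<And>n. (p n, z n) \<in> P" by metis
    have "z n \<in> (\<Union>i\<le>N m. cball (q i) (1 / 2 ^ m))" if "m < n" for m n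
      using z(1)[of n] decA[of "Suc m" n] N[of m] that by (meson Suc_leI subsetD)
    then obtain l r where r: "strict_mono (r :: nat \<Rightarrow> nat)" and l: "(z \<circ> r) \<longlonglongrightarrow> l"
      "\<And>m. l \<in> (\<Union>i\<le>N m. cball (q i) (1 / 2 ^ m))"
      by (rule subseq_limit_in_nested_covers[where z = z and N = N and q = q]) (assumption, rule that)
    have "p \<longlonglongrightarrow> y"
    proof (rule metric_LIMSEQ_I)
      fix e :: real assume "0 < e"
      then obtain m where m: "(1 / 2) ^ m < e" using real_arch_pow_inv[of e "1 / 2"] by auto
      have "dist (p n) y < e" if "m \<le> n" for n
      proof -
        have "(1 / 2) ^ n \<le> ((1 / 2) ^ m :: real)" using that by (intro power_decreasing) auto
        then show ?thesis using p[of n] m by (simp add: power_divide)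
      qed
      then show "\<exists>n0. \<forall>n\<ge>n0. dist (p n) y < e" by blast
    qed
    then have "(p \<circ> r) \<longlonglongrightarrow> y" using r by (rule LIMSEQ_subseq_LIMSEQ)
    then have "(\<lambda>n. ((p \<circ> r) n, (z \<circ> r) n)) \<longlonglongrightarrow> (y, l)" using l(1) by (rule tendsto_Pair)
    moreover have "((p \<circ> r) n, (z \<circ> r) n) \<in> P" for n using z(2) by simp
    ultimately have "(y, l) \<in> P" by (rule closed_sequentially[OF P, rotated])
    then show "y \<in> meets P K" using l(2) by (auto simp: meets_def K_def)
  qed
  let ?D = "\<lambda>n. \<phi> -` closure (meets P (A n)) \<inter> space M"
  have D[measurable]: "?D n \<in> sets M" for n by (intro measurable_sets[OF \<phi>]) auto
  have "c \<le> (INF n. emeasure M (?D n))"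
  proof (rule INF_greatest)
    fix n
    have "outer_measure_of M (?S (A n)) \<le> outer_measure_of M (?D n)"
      using closure_subset by (intro outer_measure_of_mono) blast
    also have "\<dots> = emeasure M (?D n)" by (rule outer_measure_of_eq) (rule D)
    finally show "c \<le> emeasure M (?D n)" using A(1)[of n] by simp
  qed
  also have "\<dots> = emeasure M (\<Inter>n. ?D n)"
  proof (rule INF_emeasure_decseq)
    show "decseq ?D"
    proof (rule decseq_SucI)
      fix n
      have "meets P (A (Suc n)) \<subseteq> meets P (A n)" using A(2)[of n] by (auto simp: meets_def)
      from closure_mono[OF this] show "?D (Suc n) \<subseteq> ?D n" by blast
    qed
  qed (auto simp: emeasure_eq_measure D)
  also have "\<dots> \<le> emeasure M (?S K)"
  proof (rule emeasure_mono)
    show "(\<Inter>n. ?D n) \<subseteq> ?S K" using sub by blast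
    show "?S K \<in> sets M" using closed_meets_compact[OF P K] by (intro measurable_sets[OF \<phi>]) auto
  qed
  finally show thesis using K by (intro that)
qed

text \<open>
  At stage \<open>n\<close> choose the first ball of radius \<open>1 / 2 ^ n\<close> from a fixed dense list of centres that keeps
  the fibre nonempty inside all balls chosen so far. Sets of the form \<open>meets P C\<close> with \<open>C\<close> compact are
  closed, so the choices are measurable; compactness makes the centres converge to a point of the fibre.
\<close>

lemma measurable_selection_compact:
  fixes P :: "('x::metric_space \<times> 'z::polish_space) set" and \<phi> :: "'m \<Rightarrow> 'x"
  assumes \<phi>: "\<phi> \<in> borel_measurable M" and P: "closed P" and K: "compact K"
  obtains k where "k \<in> borel_measurable M"
    "\<And>x. x \<in> space M \<Longrightarrow> \<phi> x \<in> meets P K \<Longrightarrow> (\<phi> x, k x) \<in> P"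
proof -
  note [measurable] = \<phi>
  obtain q :: "nat \<Rightarrow> 'z" where q: "\<And>z e. 0 < e \<Longrightarrow> \<exists>i. dist (q i) z < e" using dense_sequence by blast
  define C where "C = (\<lambda>is. K \<inter> (\<Inter>j<length is. cball (q (is ! j)) (1 / 2 ^ j)))"
  have C_sub: "C is \<subseteq> K" for "is" by (auto simp: C_def)
  have "compact (C is)" for "is" unfolding C_def by (intro compact_Int_closed K closed_INT) auto
  then have [measurable]: "Measurable.pred M (\<lambda>x. \<phi> x \<in> meets P (C is))" for "is"
    using closed_meets_compact[OF P, of "C is"] by (intro pred_sets2[OF _ \<phi>]) auto
  \<comment> \<open>\<open>pre x n\<close> lists the indices of the first \<open>n\<close> balls chosen for \<open>x\<close>\<close>
  define pre where "pre = (\<lambda>x. rec_nat [] (\<lambda>_ is. is @ [LEAST i. \<phi> x \<in> meets P (C (is @ [i]))]))"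
  have pre_0: "pre x 0 = []" and pre_Suc: "pre x (Suc n) = pre x n @ [LEAST i. \<phi> x \<in> meets P (C (pre x n @ [i]))]" for x n
    by (simp_all add: pre_def)
  have pre_meas[measurable]: "(\<lambda>x. pre x n) \<in> measurable M (count_space UNIV)" for n
  proof (induction n)
    case (Suc n)
    have "(\<lambda>x. is @ [LEAST i. \<phi> x \<in> meets P (C (is @ [i]))]) \<in> measurable M (count_space UNIV)" for "is"
      by (rule measurable_compose[where N = "count_space UNIV", OF measurable_Least]) measurable
    from measurable_compose_countable[OF this Suc] show ?case by (simp add: pre_Suc)
  qed (simp add: pre_0)
  have len: "length (pre x n) = n" for x n by (induction n) (simp_all add: pre_0 pre_Suc)
  define ix where "ix = (\<lambda>x n. last (pre x (Suc n)))"
  have pre_ix: "pre x n = map (ix x) [0..<n]" for x n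
    by (induction n) (simp_all add: pre_0 ix_def pre_Suc)
  have [measurable]: "(\<lambda>x. q (ix x n)) \<in> borel_measurable M" for n
    unfolding ix_def by (rule measurable_compose[OF pre_meas]) simp
  have inv: "\<phi> x \<in> meets P (C (pre x n))" if "\<phi> x \<in> meets P K" for x n
  proof (induction n)
    case 0
    then show ?case using that by (simp add: pre_0 C_def)
  next
    case (Suc n)
    then obtain z where z: "z \<in> C (pre x n)" "(\<phi> x, z) \<in> P" by (auto simp: meets_def)
    obtain i where "dist (q i) z < 1 / 2 ^ n" using q[of "1 / 2 ^ n" z] by auto
    then have "z \<in> C (pre x n @ [i])"
      using z(1) by (auto simp: C_def len nth_append less_Suc_eq)
    then have "\<phi> x \<in> meets P (C (pre x n @ [i]))" using z(2) by (auto simp: meets_def)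
    then show ?case unfolding pre_Suc by (rule LeastI)
  qed
  have lim: "\<exists>l. (\<lambda>n. q (ix x n)) \<longlonglongrightarrow> l \<and> (\<phi> x, l) \<in> P" if x: "\<phi> x \<in> meets P K" for x
  proof -
    have "\<forall>n. \<exists>z. z \<in> C (pre x n) \<and> (\<phi> x, z) \<in> P" using inv[OF x] by (auto simp: meets_def)
    then obtain z where z: "\<And>n. z n \<in> C (pre x n)" "\<And>n. (\<phi> x, z n) \<in> P" by metis
    have near: "dist (q (ix x j)) (z n) \<le> 1 / 2 ^ j" if "j < n" for j n
      using z(1)[of n] that by (auto simp: C_def pre_ix)
    have "\<forall>n. z n \<in> K" using z(1) C_sub by blast
    then obtain l r where r: "strict_mono (r :: nat \<Rightarrow> nat)" and l: "(z \<circ> r) \<longlonglongrightarrow> l"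
      using K unfolding compact_def by metis
    have "(\<phi> x, l) \<in> P"
    proof (rule closed_sequentially[OF P])
      show "(\<lambda>n. (\<phi> x, (z \<circ> r) n)) \<longlonglongrightarrow> (\<phi> x, l)" using l by (intro tendsto_Pair tendsto_const)
      show "(\<phi> x, (z \<circ> r) n) \<in> P" for n using z(2) by simp
    qed
    moreover have "(\<lambda>n. q (ix x n)) \<longlonglongrightarrow> l"
    proof (rule metric_LIMSEQ_I)
      fix e :: real assume "0 < e"
      then obtain m where m: "(1 / 2) ^ m < e" using real_arch_pow_inv[of e "1 / 2"] by auto
      have "dist (q (ix x n)) l < e" if "m \<le> n" for n
      proof -
        have "l \<in> cball (q (ix x n)) (1 / 2 ^ n)"
        proof (rule Lim_in_closed_set[OF _ _ _ l])
          show "\<forall>\<^sub>F k in sequentially. (z \<circ> r) k \<in> cball (q (ix x n)) (1 / 2 ^ n)"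
            unfolding eventually_sequentially
          proof (intro exI[of _ "Suc n"] allI impI)
            fix k assume "Suc n \<le> k"
            then have "n < r k" using seq_suble[OF r, of k] by linarith
            then show "(z \<circ> r) k \<in> cball (q (ix x n)) (1 / 2 ^ n)" using near by simp
          qed
        qed auto
        moreover have "(1 / 2) ^ n \<le> ((1 / 2) ^ m :: real)" using that by (intro power_decreasing) auto
        ultimately show ?thesis using m by (simp add: power_divide)
      qed
      then show "\<exists>n0. \<forall>n\<ge>n0. dist (q (ix x n)) l < e" by blast
    qed
    ultimately show ?thesis by blast
  qed
  have [measurable]: "Measurable.pred M (\<lambda>x. \<phi> x \<in> meets P K)"
    using closed_meets_compact[OF P K] by (intro pred_sets2[OF _ \<phi>]) auto
  define k where "k = (\<lambda>x. if \<phi> x \<in> meets P K then lim (\<lambda>n. q (ix x n)) else q 0)"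
  show thesis
  proof (rule that[of k])
    show "k \<in> borel_measurable M"
    proof (rule borel_measurable_LIMSEQ_metric)
      show "(\<lambda>x. if \<phi> x \<in> meets P K then q (ix x n) else q 0) \<in> borel_measurable M" for n by measurable
      show "(\<lambda>n. if \<phi> x \<in> meets P K then q (ix x n) else q 0) \<longlonglongrightarrow> k x" if "x \<in> space M" for x
        using lim[of x] by (auto simp: k_def limI)
    qed
    show "(\<phi> x, k x) \<in> P" if "x \<in> space M" "\<phi> x \<in> meets P K" for x
      using lim[OF that(2)] that(2) by (auto simp: k_def limI)
  qed
qed

text \<open>
  Countably many compact sets from \<open>compact_meets_large_measure\<close> exhaust the space up to a null set; use
  the selection for the first one that meets the fibre.
\<close>

theorem measurable_selection_AE:
  fixes P :: "('x::metric_space \<times> 'z::polish_space) set" and \<phi> :: "'m \<Rightarrow> 'x"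
  assumes M: "finite_measure M" and \<phi>: "\<phi> \<in> borel_measurable M" and P: "closed P"
    and fib: "\<And>x. x \<in> space M \<Longrightarrow> \<exists>z. (\<phi> x, z) \<in> P"
  obtains k where "k \<in> borel_measurable M" "AE x in M. (\<phi> x, k x) \<in> P"
proof -
  interpret finite_measure M by (rule M)
  show thesis
  proof (cases "measure M (space M) = 0")
    case True
    then have "AE x in M. False" by (intro AE_I[of _ _ "space M"]) (auto simp: emeasure_eq_measure)
    then show thesis by (intro that[of "\<lambda>_. undefined"]) (auto elim: eventually_mono)
  next
    case False
    then have pos: "0 < measure M (space M)" using zero_less_measure_iff by blast
    have "\<exists>K. compact K \<and> ennreal (measure M (space M) - 1 / Suc j) \<le> emeasure M (\<phi> -` meets P K \<inter> space M)" for j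
    proof -
      have "ennreal (measure M (space M) - 1 / Suc j) < emeasure M (space M)"
        unfolding emeasure_eq_measure using pos by (intro ennreal_lessI) auto
      from compact_meets_large_measure[OF M \<phi> P fib this] show ?thesis by metis
    qed
    then obtain K where K: "\<And>j. compact (K j)"
      and large: "\<And>j. ennreal (measure M (space M) - 1 / Suc j) \<le> emeasure M (\<phi> -` meets P (K j) \<inter> space M)"
      by metis
    have S[measurable]: "\<phi> -` meets P (K j) \<inter> space M \<in> sets M" for j
      using closed_meets_compact[OF P K] by (intro measurable_sets[OF \<phi>]) auto
    have [measurable]: "Measurable.pred M (\<lambda>x. \<phi> x \<in> meets P (K j))" for j
      using closed_meets_compact[OF P K] by (intro pred_sets2[OF _ \<phi>]) auto
    have "\<exists>k. k \<in> borel_measurable M \<and> (\<forall>x\<in>space M. \<phi> x \<in> meets P (K j) \<longrightarrow> (\<phi> x, k x) \<in> P)" for j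
      using measurable_selection_compact[OF \<phi> P K, of j] by metis
    then obtain k where k[measurable]: "\<And>j. k j \<in> borel_measurable M"
      and kP: "\<And>j x. x \<in> space M \<Longrightarrow> \<phi> x \<in> meets P (K j) \<Longrightarrow> (\<phi> x, k j x) \<in> P" by metis
    define J where "J = (\<lambda>x. LEAST j. \<phi> x \<in> meets P (K j))"
    have [measurable]: "J \<in> measurable M (count_space UNIV)" unfolding J_def by measurable
    let ?U = "\<Union>j. \<phi> -` meets P (K j) \<inter> space M"
    have "measure M (space M) \<le> measure M ?U"
    proof (rule field_le_epsilon)
      fix e :: real assume "0 < e"
      then obtain j where j: "1 / Suc j < e" using nat_approx_posE by blast
      have "measure M (space M) - 1 / Suc j \<le> measure M (\<phi> -` meets P (K j) \<inter> space M)"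
        using large[of j] by (simp add: emeasure_eq_measure ennreal_le_iff)
      also have "\<dots> \<le> measure M ?U" by (intro finite_measure_mono) auto
      finally show "measure M (space M) \<le> measure M ?U + e" using j by simp
    qed
    then have "measure M ?U = measure M (space M)"
      by (intro antisym finite_measure_mono[of ?U "space M"]) auto
    then have "measure M (space M - ?U) = 0" by (subst finite_measure_Diff) auto
    then have "space M - ?U \<in> null_sets M" by (auto simp: null_sets_def emeasure_eq_measure)
    from AE_not_in[OF this] AE_space have "AE x in M. x \<in> ?U" by eventually_elim blast
    then have "AE x in M. (\<phi> x, k (J x) x) \<in> P"
    proof eventually_elim
      case (elim x)
      then obtain j where "x \<in> space M" "\<phi> x \<in> meets P (K j)" by blast
      then show ?case using kP[of x "J x"] LeastI[of "\<lambda>j. \<phi> x \<in> meets P (K j)" j] by (simp add: J_def)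
    qed
    moreover have "(\<lambda>x. k (J x) x) \<in> borel_measurable M"
      by (rule measurable_compose_countable[where f = k]) measurable
    ultimately show thesis by (intro that)
  qed
qed

section \<open>From midpoints in the target to paths of maps\<close>

lemma second_countable_euclidean: "second_countable (euclidean :: 'n::second_countable_topology topology)"
proof -
  obtain B :: "'n set set" where B: "countable B" "topological_basis B" using ex_countable_basis by blast
  show ?thesis
    unfolding second_countable_def
    using B topological_basis_open[OF B(2)] by (intro exI[of _ B]) (auto elim!: topological_basisE[OF B(2)])
qed

text \<open>
  Every subset of a second countable space is separable.
\<close>

lemma sep_maps_eq: "(sep_maps M :: ('m \<Rightarrow> 'n::{metric_space, second_countable_topology}) set) = borel_measurable M"
  unfolding sep_maps_def
  using second_countable_imp_separable_space[OF second_countable_subtopology[OF second_countable_euclidean]] by auto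

definition ae_class :: "'m measure \<Rightarrow> ('m \<Rightarrow> 'n::metric_space) \<Rightarrow> ('m \<Rightarrow> 'n) set" where
  "ae_class M f = ae_rel M `` {f}"

lemma ae_class:
  fixes f :: "'m \<Rightarrow> 'n::{metric_space, second_countable_topology}"
  assumes "f \<in> borel_measurable M"
  shows "ae_class M f \<in> L0 M" "f \<in> ae_class M f"
  using assms equiv_class_self[OF equiv_ae_rel, of f M] quotientI[of f "sep_maps M" "ae_rel M"]
  by (auto simp: ae_class_def L0_def sep_maps_eq)

lemma ae_class_eq:
  fixes f :: "'m \<Rightarrow> 'n::{metric_space, second_countable_topology}"
  assumes "F \<in> L0 M" "f \<in> F" "g \<in> borel_measurable M" "AE x in M. g x = f x"
  shows "ae_class M g = F"
  using assms by (intro L0_eqI[of _ M _ g f] ae_class)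

lemma Dp_fun_le_scale:
  assumes c: "0 \<le> c" and p: "1 < p" and A: "0 \<le> A" "Dp_fun M p f g \<le> ennreal A"
    and le: "\<And>x. x \<in> space M \<Longrightarrow> dist (f' x) (g' x) \<le> c * dist (f x) (g x)"
    and [measurable]: "(\<lambda>x. dist (f x) (g x)) \<in> borel_measurable M"
  shows "Dp_fun M p f' g' \<le> ennreal (c * A)"
proof -
  have "(\<integral>\<^sup>+x. ennreal (dist (f' x) (g' x) powr p) \<partial>M) \<le> (\<integral>\<^sup>+x. ennreal (c powr p) * ennreal (dist (f x) (g x) powr p) \<partial>M)"
  proof (rule nn_integral_mono)
    fix x assume "x \<in> space M"
    then have "dist (f' x) (g' x) powr p \<le> (c * dist (f x) (g x)) powr p"
      using p le by (intro powr_mono2) auto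
    also have "\<dots> = c powr p * dist (f x) (g x) powr p" using c by (simp add: powr_mult)
    finally show "ennreal (dist (f' x) (g' x) powr p) \<le> ennreal (c powr p) * ennreal (dist (f x) (g x) powr p)"
      by (simp add: ennreal_mult[symmetric] ennreal_leI)
  qed
  also have "\<dots> = ennreal (c powr p) * (\<integral>\<^sup>+x. ennreal (dist (f x) (g x) powr p) \<partial>M)"
    by (rule nn_integral_cmult) measurable
  also have "\<dots> \<le> ennreal (c powr p) * ennreal (A powr p)"
    using A p unfolding Dp_fun_def by (intro mult_left_mono) (auto simp: ennreal_powr_le_iff)
  also have "\<dots> = ennreal ((c * A) powr p)" using c A by (simp add: powr_mult ennreal_mult)
  finally show ?thesis using p c A unfolding Dp_fun_def by (subst ennreal_powr_le_iff) auto
qed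

lemma Lp_dist_reps:
  fixes F G :: "('m \<Rightarrow> 'n::{metric_space, second_countable_topology}) set"
  assumes "h \<in> L0 M" "1 < p" "F \<in> Lp M p h" "G \<in> Lp M p h" "f \<in> F" "g \<in> G"
  shows "Dp_fun M p f g = ennreal (Lp_dist M p F G)"
proof -
  have "Dp M p F G < \<infinity>" using Dp_finite[of h M p F G] assms by simp
  moreover have "Dp M p F G = Dp_fun M p f g"
    using assms by (intro Dp_eq) (auto simp: Lp_def)
  ultimately show ?thesis unfolding Lp_dist_def by (simp add: less_top[symmetric])
qed

lemma measurable_midpoint_map:
  fixes f g :: "'m \<Rightarrow> 'n::polish_space"
  assumes N: "finite_measure N" and [measurable]: "f \<in> borel_measurable N" "g \<in> borel_measurable N"
    and mid: "has_midpoints \<kappa> (UNIV :: 'n set) dist"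
  obtains k where "k \<in> borel_measurable N"
    "AE x in N. dist (f x) (k x) \<le> \<kappa> / 2 * dist (f x) (g x) \<and> dist (k x) (g x) \<le> \<kappa> / 2 * dist (f x) (g x)"
proof -
  define P where "P = {w :: ('n \<times> 'n) \<times> 'n.
    dist (fst (fst w)) (snd w) \<le> \<kappa> / 2 * dist (fst (fst w)) (snd (fst w)) \<and>
    dist (snd w) (snd (fst w)) \<le> \<kappa> / 2 * dist (fst (fst w)) (snd (fst w))}"
  have cl: "closed P"
    unfolding P_def by (intro closed_Collect_conj closed_Collect_le continuous_intros)
  have me: "(\<lambda>x. (f x, g x)) \<in> borel_measurable N" by measurable
  have ex: "\<exists>z. ((f x, g x), z) \<in> P" for x
    using mid by (simp add: P_def has_midpoints_def)
  obtain k where "k \<in> borel_measurable N" "AE x in N. ((f x, g x), k x) \<in> P"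
    by (rule measurable_selection_AE[OF N me cl ex])
  then show thesis by (intro that[of k]) (simp_all add: P_def)
qed

lemma dyadic_refine_mem:
  assumes "\<And>n f g. f \<in> S \<Longrightarrow> g \<in> S \<Longrightarrow> mid n f g \<in> S" "x \<in> S" "y \<in> S"
  shows "dyadic_refine mid x y n k \<in> S"
  by (induction n arbitrary: k) (use assms in auto)

text \<open>
  The selection theorem wants a finite measure, and the one with density \<open>d(f x, g x)\<^sup>p\<close> is finite. It
  ignores the points where \<open>f\<close> and \<open>g\<close> agree, but there the path can be taken constant. Off a null set
  all dyadic bounds hold at once, and the limit is formed pointwise.
\<close>

lemma measurable_Lipschitz_paths:
  fixes f g :: "'m \<Rightarrow> 'n::polish_space"
  assumes [measurable]: "f \<in> borel_measurable M" "g \<in> borel_measurable M"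
    and fin: "(\<integral>\<^sup>+x. ennreal (dist (f x) (g x) powr p) \<partial>M) < \<infinity>"
    and \<kappa>: "1 \<le> \<kappa>" and mid: "\<And>n. has_midpoints (refine_factor \<kappa> n) (UNIV :: 'n set) dist"
  obtains \<gamma> where "\<And>t. 0 \<le> t \<Longrightarrow> \<gamma> t \<in> borel_measurable M" "\<And>x. x \<in> space M \<Longrightarrow> \<gamma> 0 x = f x"
    "AE x in M. \<gamma> 1 x = g x"
    "\<And>s t x. x \<in> space M \<Longrightarrow> 0 \<le> s \<Longrightarrow> s \<le> t \<Longrightarrow> dist (\<gamma> s x) (\<gamma> t x) \<le> \<kappa> * (t - s) * dist (f x) (g x)"
proof -
  define N where "N = density M (\<lambda>x. ennreal (dist (f x) (g x) powr p))"
  have N: "finite_measure N"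
    using fin by (intro finite_measureI) (simp add: N_def emeasure_density cong: nn_integral_cong)
  have [measurable_cong]: "sets N = sets M" by (simp add: N_def)
  have meas_eq: "borel_measurable N = (borel_measurable M :: ('m \<Rightarrow> 'n) set)"
    by (rule measurable_cong_sets) (simp_all add: N_def)
  define is_mid where "is_mid = (\<lambda>n (f :: 'm \<Rightarrow> 'n) g k x.
    dist (f x) (k x) \<le> refine_factor \<kappa> n / 2 * dist (f x) (g x) \<and> dist (k x) (g x) \<le> refine_factor \<kappa> n / 2 * dist (f x) (g x))"
  \<comment> \<open>put as an implication so that the choice function is defined on all pairs of maps\<close>
  have "\<exists>k. f \<in> borel_measurable M \<longrightarrow> g \<in> borel_measurable M \<longrightarrow> k \<in> borel_measurable M \<and> (AE x in N. is_mid n f g k x)"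
    for n and f g :: "'m \<Rightarrow> 'n"
  proof (cases "f \<in> borel_measurable M \<and> g \<in> borel_measurable M")
    case True
    then have "f \<in> borel_measurable N" "g \<in> borel_measurable N" by (simp_all add: meas_eq)
    then obtain k where "k \<in> borel_measurable N" "AE x in N. is_mid n f g k x"
      unfolding is_mid_def by (rule measurable_midpoint_map[OF N _ _ mid[of n]])
    then show ?thesis by (auto simp: meas_eq)
  qed auto
  then have "\<exists>Mid. \<forall>n f g. f \<in> borel_measurable M \<longrightarrow> g \<in> borel_measurable M \<longrightarrow>
      Mid n f g \<in> borel_measurable M \<and> (AE x in N. is_mid n f g (Mid n f g) x)"
    by (intro choice allI)
  then obtain Mid where Mid_meas: "\<And>n f g. f \<in> borel_measurable M \<Longrightarrow> g \<in> borel_measurable M \<Longrightarrow> Mid n f g \<in> borel_measurable M"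
    and Mid: "\<And>n f g. f \<in> borel_measurable M \<Longrightarrow> g \<in> borel_measurable M \<Longrightarrow> AE x in N. is_mid n f g (Mid n f g) x"
    by blast
  define G where "G = dyadic_refine Mid f g"
  have G_meas[measurable]: "G n k \<in> borel_measurable M" for n k
    unfolding G_def by (rule dyadic_refine_mem) (use Mid_meas assms(1,2) in auto)
  have even: "G (Suc n) (2 * k) = G n k" for n k by (simp add: G_def)
  have odd: "G (Suc n) (2 * k + 1) = Mid n (G n k) (G n (Suc k))" for n k by (simp add: G_def)
  have G_end: "G n (2 ^ n) = g" for n by (simp add: G_def)
  define good where "good = (\<lambda>x. f x \<noteq> g x \<and> (\<forall>n k. dist (G n k x) (G n (Suc k) x) \<le> \<kappa> * dist (f x) (g x) / 2 ^ n))"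
  have [measurable]: "Measurable.pred M good" unfolding good_def by measurable
  have "AE x in N. \<forall>n k. is_mid n (G n k) (G n (Suc k)) (G (Suc n) (2 * k + 1)) x"
    unfolding AE_all_countable odd using Mid G_meas by blast
  then have "AE x in N. \<forall>n k. dist (G n k x) (G n (Suc k) x) \<le> \<kappa> * dist (f x) (g x) / 2 ^ n"
  proof eventually_elim
    case (elim x)
    show ?case
    proof (intro allI)
      fix n k
      show "dist (G n k x) (G n (Suc k) x) \<le> \<kappa> * dist (f x) (g x) / 2 ^ n"
      proof (rule dyadic_refine_step[of \<kappa> "\<lambda>n k. G n k x", OF \<kappa>])
        show "dist (G 0 k x) (G 0 (Suc k) x) \<le> dist (f x) (g x)" for k by (simp add: G_def)
        show "G (Suc n) (2 * k) x = G n k x" for n k by (simp add: even)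
      qed (use elim in \<open>simp_all only: is_mid_def\<close>)
    qed
  qed
  then have "AE x in M. 0 < ennreal (dist (f x) (g x) powr p) \<longrightarrow>
      (\<forall>n k. dist (G n k x) (G n (Suc k) x) \<le> \<kappa> * dist (f x) (g x) / 2 ^ n)"
    unfolding N_def by (subst (asm) AE_density) auto
  then have good_AE: "AE x in M. f x \<noteq> g x \<longrightarrow> good x" by eventually_elim (simp add: good_def)
  \<comment> \<open>on bad points constant paths keep the bounds valid everywhere\<close>
  define H where "H = (\<lambda>n k x. if good x then G n k x else f x)"
  have [measurable]: "H n k \<in> borel_measurable M" for n k unfolding H_def by measurable
  have "\<exists>\<gamma>. (\<forall>t\<ge>0. (\<lambda>n. H n (nat \<lfloor>2 ^ n * t\<rfloor>) x) \<longlonglongrightarrow> \<gamma> t) \<and>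
      (\<forall>s t. 0 \<le> s \<longrightarrow> s \<le> t \<longrightarrow> dist (\<gamma> s) (\<gamma> t) \<le> \<kappa> * dist (f x) (g x) * (t - s))" for x
  proof -
    have e: "H (Suc n) (2 * k) x = H n k x" for n k by (simp add: H_def even)
    have "dist (H n k x) (H n (Suc k) x) \<le> \<kappa> * dist (f x) (g x) / 2 ^ n" for n k
      using \<kappa> by (cases "good x") (simp_all add: H_def, simp add: good_def)
    from dyadic_limit_path[of "\<lambda>n k. H n k x", OF e this] show ?thesis by metis
  qed
  then have "\<exists>\<gamma>. \<forall>x. (\<forall>t\<ge>0. (\<lambda>n. H n (nat \<lfloor>2 ^ n * t\<rfloor>) x) \<longlonglongrightarrow> \<gamma> x t) \<and>
      (\<forall>s t. 0 \<le> s \<longrightarrow> s \<le> t \<longrightarrow> dist (\<gamma> x s) (\<gamma> x t) \<le> \<kappa> * dist (f x) (g x) * (t - s))"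
    by (intro choice allI)
  then obtain \<gamma> where \<gamma>: "\<And>x t. 0 \<le> t \<Longrightarrow> (\<lambda>n. H n (nat \<lfloor>2 ^ n * t\<rfloor>) x) \<longlonglongrightarrow> \<gamma> x t"
    and lip: "\<And>x s t. 0 \<le> s \<Longrightarrow> s \<le> t \<Longrightarrow> dist (\<gamma> x s) (\<gamma> x t) \<le> \<kappa> * dist (f x) (g x) * (t - s)"
    by blast
  have \<gamma>0: "\<gamma> x 0 = f x" for x
    using \<gamma>[of 0 x] by (simp add: H_def G_def LIMSEQ_const_iff cong: if_cong)
  have \<gamma>1: "\<gamma> x 1 = (if good x then g x else f x)" for x
    using \<gamma>[of 1 x] by (cases "good x") (simp_all add: H_def G_end LIMSEQ_const_iff nat_power_eq)
  show thesis
  proof (rule that[of "\<lambda>t x. \<gamma> x t"])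
    show "(\<lambda>x. \<gamma> x t) \<in> borel_measurable M" if "0 \<le> t" for t
      by (rule borel_measurable_LIMSEQ_metric[of "\<lambda>n. H n (nat \<lfloor>2 ^ n * t\<rfloor>)"]) (use \<gamma>[OF that] in auto)
    show "\<gamma> x 0 = f x" for x by (rule \<gamma>0)
    show "AE x in M. \<gamma> x 1 = g x" using good_AE by eventually_elim (auto simp: \<gamma>1)
    show "dist (\<gamma> x s) (\<gamma> x t) \<le> \<kappa> * (t - s) * dist (f x) (g x)" if "0 \<le> s" "s \<le> t" for s t x
      using lip[OF that, of x] by (simp add: mult_ac)
  qed
qed

text \<open>
  A pointwise Lipschitz bound proportional to \<open>d(f x, g x)\<close> integrates to a Lipschitz bound in \<open>L\<^sup>p\<close>.
\<close>

theorem Lp_has_Lipschitz_paths: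
  fixes h :: "('m \<Rightarrow> 'n::polish_space) set"
  assumes h: "h \<in> L0 M" and p: "1 < p" and \<kappa>: "1 \<le> \<kappa>"
    and mid: "\<And>n. has_midpoints (refine_factor \<kappa> n) (UNIV :: 'n set) dist"
  shows "has_Lipschitz_paths \<kappa> (Lp M p h) (Lp_dist M p)"
  unfolding has_Lipschitz_paths_def
proof (intro ballI)
  fix F G assume F: "F \<in> Lp M p h" and G: "G \<in> Lp M p h"
  then have F0: "F \<in> L0 M" and G0: "G \<in> L0 M" by (auto simp: Lp_def)
  obtain f g where f: "f \<in> F" and g: "g \<in> G" using L0_rep[OF F0] L0_rep[OF G0] by blast
  have meas[measurable]: "f \<in> borel_measurable M" "g \<in> borel_measurable M"
    using L0_measurable F0 G0 f g by blast+
  define A where "A = Lp_dist M p F G"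
  have A: "0 \<le> A" "Dp_fun M p f g \<le> ennreal A"
    using Lp_dist_reps[OF h p F G f g] by (simp_all add: A_def Lp_dist_def)
  have "(\<integral>\<^sup>+x. ennreal (dist (f x) (g x) powr p) \<partial>M) \<le> ennreal (A powr p)"
    using A p unfolding Dp_fun_def by (subst (asm) ennreal_powr_le_iff) auto
  then have fin: "(\<integral>\<^sup>+x. ennreal (dist (f x) (g x) powr p) \<partial>M) < \<infinity>"
    by (rule order.strict_trans1) simp
  obtain \<gamma> where \<gamma>_meas: "\<And>t. 0 \<le> t \<Longrightarrow> \<gamma> t \<in> borel_measurable M"
    and \<gamma>0: "\<And>x. x \<in> space M \<Longrightarrow> \<gamma> 0 x = f x" and \<gamma>1: "AE x in M. \<gamma> 1 x = g x"
    and lip: "\<And>s t x. x \<in> space M \<Longrightarrow> 0 \<le> s \<Longrightarrow> s \<le> t \<Longrightarrow> dist (\<gamma> s x) (\<gamma> t x) \<le> \<kappa> * (t - s) * dist (f x) (g x)"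
    by (rule measurable_Lipschitz_paths[OF meas fin \<kappa> mid]) (rule that)
  define \<Gamma> where "\<Gamma> = (\<lambda>t. ae_class M (\<gamma> t))"
  have \<Gamma>: "\<Gamma> t \<in> L0 M" "\<gamma> t \<in> \<Gamma> t" if "0 \<le> t" for t
    unfolding \<Gamma>_def using ae_class[OF \<gamma>_meas[OF that]] by auto
  have dist_le: "Dp M p (\<Gamma> s) (\<Gamma> t) \<le> ennreal (\<kappa> * (t - s) * A)" if st: "0 \<le> s" "s \<le> t" for s t
  proof -
    have t: "0 \<le> t" using st by simp
    have "Dp M p (\<Gamma> s) (\<Gamma> t) = Dp_fun M p (\<gamma> s) (\<gamma> t)"
      by (intro Dp_eq \<Gamma> st(1) t)
    also have "\<dots> \<le> ennreal (\<kappa> * (t - s) * A)"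
      by (rule Dp_fun_le_scale[OF _ p A]) (use lip st \<kappa> in auto)
    finally show ?thesis .
  qed
  have \<Gamma>0: "\<Gamma> 0 = F" unfolding \<Gamma>_def using \<gamma>0 by (intro ae_class_eq[OF F0 f] \<gamma>_meas) auto
  have \<Gamma>1: "\<Gamma> 1 = G" unfolding \<Gamma>_def using \<gamma>1 by (intro ae_class_eq[OF G0 g] \<gamma>_meas) auto
  have \<Gamma>_Lp: "\<Gamma> t \<in> Lp M p h" if t: "0 \<le> t" for t
  proof -
    have "Dp M p (\<Gamma> t) h \<le> Dp M p (\<Gamma> t) (\<Gamma> 0) + Dp M p (\<Gamma> 0) h"
      using p by (intro Dp_triangle \<Gamma> t h) auto
    also have "\<dots> < \<infinity>"
    proof -
      have "Dp M p (\<Gamma> t) (\<Gamma> 0) \<le> ennreal (\<kappa> * (t - 0) * A)"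
        using dist_le[OF order_refl t] by (simp add: Dp_commute[of M p "\<Gamma> t"])
      also have "\<dots> < \<infinity>" by simp
      finally have "Dp M p (\<Gamma> t) (\<Gamma> 0) < \<infinity>" .
      moreover have "Dp M p (\<Gamma> 0) h < \<infinity>" using F by (simp add: \<Gamma>0 Lp_def)
      ultimately show ?thesis by simp
    qed
    finally show ?thesis using \<Gamma>(1)[OF t] by (simp add: Lp_def)
  qed
  show "\<exists>\<gamma>. \<gamma> \<in> {0..1} \<rightarrow> Lp M p h \<and> \<gamma> 0 = F \<and> \<gamma> 1 = G \<and>
      (\<forall>s t. 0 \<le> s \<longrightarrow> s \<le> t \<longrightarrow> t \<le> 1 \<longrightarrow> Lp_dist M p (\<gamma> s) (\<gamma> t) \<le> \<kappa> * Lp_dist M p F G * (t - s))"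
  proof (intro exI[of _ \<Gamma>] conjI allI impI)
    show "\<Gamma> \<in> {0..1} \<rightarrow> Lp M p h" using \<Gamma>_Lp by auto
    fix s t :: real assume st: "0 \<le> s" "s \<le> t"
    have "Lp_dist M p (\<Gamma> s) (\<Gamma> t) \<le> \<kappa> * (t - s) * A"
      unfolding Lp_dist_def using dist_le[OF st] \<kappa> st A by (intro enn2real_leI) auto
    then show "Lp_dist M p (\<Gamma> s) (\<Gamma> t) \<le> \<kappa> * Lp_dist M p F G * (t - s)"
      by (simp add: A_def mult_ac)
  qed (fact \<Gamma>0 \<Gamma>1)+
qed

section \<open>From midpoints of maps to midpoints in the target\<close>

text \<open>
  How far the \<open>p\<close>-th power lies above its tangent at \<open>a\<close>. If \<open>u + v \<ge> 2 a\<close>, the linear parts at \<open>u\<close> and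
  \<open>v\<close> add up to something nonnegative, so the two gaps together are at most the excess of \<open>u\<^sup>p + v\<^sup>p\<close>
  over \<open>2 a\<^sup>p\<close>.
\<close>

definition tangent_gap :: "real \<Rightarrow> real \<Rightarrow> real \<Rightarrow> real" where
  "tangent_gap p a t = t powr p - a powr p - p * a powr (p - 1) * (t - a)"

lemma tangent_gap_deriv:
  assumes "0 < t"
  shows "(tangent_gap p a has_real_derivative p * t powr (p - 1) - p * a powr (p - 1)) (at t)"
  unfolding tangent_gap_def
  by (rule derivative_eq_intros has_real_derivative_powr assms refl)+ simp

lemma tangent_gap_at [simp]: "tangent_gap p a a = 0"
  by (simp add: tangent_gap_def)

lemma tangent_gap_strict_mono:
  assumes p: "1 < p" and a: "0 < a" "a \<le> s" "s < t"
  shows "tangent_gap p a s < tangent_gap p a t"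
proof (rule DERIV_pos_imp_increasing_open[OF a(3)])
  fix x assume x: "s < x" "x < t"
  then have "a powr (p - 1) < x powr (p - 1)" using p a by (intro powr_less_mono2) auto
  then have "0 < p * x powr (p - 1) - p * a powr (p - 1)" using p by simp
  moreover have "0 < x" using x a by simp
  ultimately show "\<exists>y. (tangent_gap p a has_real_derivative y) (at x) \<and> 0 < y" using tangent_gap_deriv by blast
next
  show "continuous_on {s..t} (tangent_gap p a)"
    unfolding tangent_gap_def using a p by (intro continuous_intros) auto
qed

lemma tangent_gap_nonneg:
  assumes p: "1 < p" and a: "0 < a" and t: "0 \<le> t"
  shows "0 \<le> tangent_gap p a t"
proof (cases "a \<le> t")
  case True
  then show ?thesis using tangent_gap_strict_mono[OF p a order_refl, of t] by (cases "a = t") auto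
next
  case False
  then have "t < a" by simp
  have "tangent_gap p a a < tangent_gap p a t"
  proof (rule DERIV_neg_imp_decreasing_open[OF \<open>t < a\<close>])
    fix x assume x: "t < x" "x < a"
    then have "x powr (p - 1) < a powr (p - 1)" using p t by (intro powr_less_mono2) auto
    then have "p * x powr (p - 1) - p * a powr (p - 1) < 0" using p by simp
    moreover have "0 < x" using x t by simp
    ultimately show "\<exists>y. (tangent_gap p a has_real_derivative y) (at x) \<and> y < 0" using tangent_gap_deriv by blast
  next
    show "continuous_on {t..a} (tangent_gap p a)"
      unfolding tangent_gap_def using t p by (intro continuous_on_diff continuous_on_powr' continuous_intros) auto
  qed
  then show ?thesis by simp
qed

lemma tangent_gap_le_of_sum:
  assumes p: "1 < p" and a: "0 < a" and uv: "0 \<le> u" "0 \<le> v" "2 * a \<le> u + v"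
    and sum: "u powr p + v powr p \<le> c"
  shows "tangent_gap p a u \<le> c - 2 * a powr p"
proof -
  have "0 \<le> p * a powr (p - 1) * (u + v - 2 * a)" using p uv by simp
  moreover have "tangent_gap p a u + tangent_gap p a v
      = u powr p + v powr p - 2 * a powr p - p * a powr (p - 1) * (u + v - 2 * a)"
    by (simp add: tangent_gap_def algebra_simps)
  ultimately show ?thesis using sum tangent_gap_nonneg[OF p a uv(2)] by linarith
qed

text \<open>
  If \<open>u > \<kappa> a\<close>, the gap at \<open>u\<close> is at least its value \<open>\<rho>\<close> at \<open>\<kappa> a\<close>. The factor \<open>\<kappa>'\<close> is chosen to
  allow an excess of only \<open>\<rho> / 2\<close>.
\<close>

lemma near_equality_forces_midpoint:
  fixes p a \<kappa> :: real
  assumes p: "1 < p" and a: "0 < a" and \<kappa>: "1 < \<kappa>"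
  obtains \<kappa>' where "1 < \<kappa>'"
    "\<And>u v. 0 \<le> u \<Longrightarrow> 0 \<le> v \<Longrightarrow> 2 * a \<le> u + v \<Longrightarrow> u powr p + v powr p \<le> 2 * (\<kappa>' * a) powr p \<Longrightarrow> u \<le> \<kappa> * a"
proof -
  define \<rho> where "\<rho> = tangent_gap p a (\<kappa> * a)"
  have \<rho>: "0 < \<rho>" using tangent_gap_strict_mono[OF p a order_refl, of "\<kappa> * a"] a \<kappa> by (simp add: \<rho>_def)
  define \<kappa>' where "\<kappa>' = (1 + \<rho> / (4 * a powr p)) powr (1 / p)"
  have pos: "0 < \<rho> / (4 * a powr p)" using \<rho> a by simp
  have "1 < \<kappa>'" unfolding \<kappa>'_def using pos p by (intro gr_one_powr) auto
  have "(\<kappa>' * a) powr p = (1 + \<rho> / (4 * a powr p)) * a powr p"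
    using p a pos by (simp add: powr_mult \<kappa>'_def powr_powr)
  also have "\<dots> = a powr p + \<rho> / 4" using a by (simp add: field_simps)
  finally have eq: "2 * (\<kappa>' * a) powr p = 2 * a powr p + \<rho> / 2" by simp
  show thesis
  proof (rule that[OF \<open>1 < \<kappa>'\<close>])
    fix u v :: real
    assume uv: "0 \<le> u" "0 \<le> v" "2 * a \<le> u + v" "u powr p + v powr p \<le> 2 * (\<kappa>' * a) powr p"
    have "tangent_gap p a u < \<rho>"
      using tangent_gap_le_of_sum[OF p a uv] \<rho> unfolding eq by simp
    then show "u \<le> \<kappa> * a"
      using tangent_gap_strict_mono[OF p a, of "\<kappa> * a" u] a \<kappa> unfolding \<rho>_def by (cases "u \<le> \<kappa> * a") auto
  qed
qed

lemma equality_forces_midpoint: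
  fixes p a u v :: real
  assumes p: "1 < p" and a: "0 < a"
    and uv: "0 \<le> u" "0 \<le> v" "2 * a \<le> u + v" "u powr p + v powr p \<le> 2 * a powr p"
  shows "u \<le> a"
proof (rule ccontr)
  assume "\<not> u \<le> a"
  then have "0 < tangent_gap p a u" using tangent_gap_strict_mono[OF p a order_refl, of u] by simp
  then show False using tangent_gap_le_of_sum[OF p a uv] by simp
qed

lemma exists_le_average:
  fixes f :: "'m \<Rightarrow> real"
  assumes [measurable]: "f \<in> borel_measurable M" "B \<in> sets M"
    and B: "0 < emeasure M B" "emeasure M B < \<infinity>" and c: "0 \<le> c"
    and le: "(\<integral>\<^sup>+x\<in>B. ennreal (f x) \<partial>M) \<le> ennreal c * emeasure M B"
  shows "\<exists>x\<in>B. f x \<le> c"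
proof (rule ccontr)
  assume "\<not> (\<exists>x\<in>B. f x \<le> c)"
  then have gt: "c < f x" if "x \<in> B" for x using that by (meson not_le)
  have "(\<integral>\<^sup>+x\<in>B. ennreal (f x) \<partial>M) = (\<integral>\<^sup>+x. ennreal (f x - c) * indicator B x + ennreal c * indicator B x \<partial>M)"
    using c by (intro nn_integral_cong)
      (auto simp: indicator_def ennreal_plus[symmetric] less_imp_le[OF gt] simp del: ennreal_plus)
  also have "\<dots> = (\<integral>\<^sup>+x\<in>B. ennreal (f x - c) \<partial>M) + ennreal c * emeasure M B"
    by (subst nn_integral_add) (auto simp: nn_integral_cmult_indicator)
  finally have "(\<integral>\<^sup>+x\<in>B. ennreal (f x - c) \<partial>M) + ennreal c * emeasure M B \<le> 0 + ennreal c * emeasure M B"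
    using le by simp
  moreover have "ennreal c * emeasure M B < top" using B by (simp add: ennreal_mult_less_top)
  ultimately have "(\<integral>\<^sup>+x\<in>B. ennreal (f x - c) \<partial>M) = 0"
    by (cases "\<integral>\<^sup>+x\<in>B. ennreal (f x - c) \<partial>M"; cases "ennreal c * emeasure M B")
      (auto simp: top_unique simp flip: ennreal_plus)
  then have "AE x in M. ennreal (f x - c) * indicator B x = 0"
    by (subst (asm) nn_integral_0_iff_AE) auto
  then have "AE x in M. x \<notin> B"
    by eventually_elim (use gt in \<open>force simp: indicator_def\<close>)
  then have "emeasure M B = 0" by (simp add: AE_iff_null_sets null_setsD1)
  with B show False by simp
qed

text \<open>
  A set of positive finite measure is the increasing union of its parts on which \<open>k\<close> stays within
  distance \<open>n\<close> of \<open>y\<close>, so one of these parts has positive measure.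
\<close>

lemma positive_finite_measure_subset_bounded:
  fixes k :: "'m \<Rightarrow> 'n::{metric_space, second_countable_topology}"
  assumes M: "\<not> purely_infinite M" and [measurable]: "k \<in> borel_measurable M"
  obtains B r where "B \<in> sets M" "0 < emeasure M B" "emeasure M B < \<infinity>" "0 \<le> r" "\<And>x. x \<in> B \<Longrightarrow> dist y (k x) \<le> r"
proof -
  obtain A where A[measurable]: "A \<in> sets M" and A0: "emeasure M A \<noteq> 0" "emeasure M A \<noteq> \<infinity>"
    using M by (auto simp: purely_infinite_def)
  define B where "B = (\<lambda>n::nat. {x\<in>space M. x \<in> A \<and> dist y (k x) \<le> real n})"
  have B[measurable]: "B n \<in> sets M" for n unfolding B_def by measurable
  have A_eq: "A = (\<Union>n. B n)"
    using sets.sets_into_space[OF A] by (auto simp: B_def real_arch_simple)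
  have "\<exists>n. emeasure M (B n) \<noteq> 0"
  proof (rule ccontr)
    assume "\<not> ?thesis"
    then have "emeasure M (\<Union>n. B n) = 0" using B by (intro emeasure_UN_eq_0) auto
    with A0 show False by (simp add: A_eq)
  qed
  then obtain n where n: "emeasure M (B n) \<noteq> 0" by blast
  have "emeasure M (B n) \<le> emeasure M A" by (intro emeasure_mono) (auto simp: B_def)
  then have "emeasure M (B n) < \<infinity>" using A0 by (simp add: less_top order.strict_trans1)
  with n show thesis by (intro that[of "B n" "real n"]) (auto simp: B_def zero_less_iff_neq_zero)
qed

text \<open>
  The maps \<open>q y\<close> and \<open>q z\<close> are constant on \<open>B\<close> and equal to the base map elsewhere; they belong to the space
  because the base map is bounded on \<open>B\<close>. Summing the two inequalities for their midpoint and comparing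
  with the average over \<open>B\<close> yields a point of \<open>B\<close> at which the inequality holds without integrals.
\<close>

lemma Lp_midpoint_gives_near_midpoint:
  fixes h :: "('m \<Rightarrow> 'n::polish_space) set" and y z :: 'n
  assumes h: "h \<in> L0 M" and p: "1 < p" and M: "\<not> purely_infinite M"
    and \<kappa>: "0 \<le> \<kappa>" and mid: "has_midpoints \<kappa> (Lp M p h) (Lp_dist M p)"
  obtains w where "dist y w powr p + dist w z powr p \<le> 2 * (\<kappa> / 2 * dist y z) powr p"
proof -
  obtain k where k: "k \<in> h" using L0_rep[OF h] by blast
  have k_meas[measurable]: "k \<in> borel_measurable M" using L0_measurable[OF h k] .
  obtain B r where B[measurable]: "B \<in> sets M" and B_pos: "0 < emeasure M B" "emeasure M B < \<infinity>"
    and r: "0 \<le> r" "\<And>x. x \<in> B \<Longrightarrow> dist y (k x) \<le> r"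
    using positive_finite_measure_subset_bounded[OF M k_meas, of y] by metis
  obtain \<mu> where \<mu>: "emeasure M B = ennreal \<mu>" "0 < \<mu>"
    using B_pos by (cases "emeasure M B") auto
  define q where "q = (\<lambda>w x. if x \<in> B then w else k x)"
  have q_meas[measurable]: "q w \<in> borel_measurable M" for w unfolding q_def by measurable
  have q_Lp: "ae_class M (q w) \<in> Lp M p h" for w
  proof -
    have "(\<integral>\<^sup>+x. ennreal (dist (q w x) (k x) powr p) \<partial>M) \<le> (\<integral>\<^sup>+x. ennreal ((dist w y + r) powr p) * indicator B x \<partial>M)"
    proof (rule nn_integral_mono)
      fix x
      have "dist w (k x) powr p \<le> (dist w y + r) powr p" if "x \<in> B"
        using p r(2)[OF that] dist_triangle[of w "k x" y] by (intro powr_mono2) auto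
      then show "ennreal (dist (q w x) (k x) powr p) \<le> ennreal ((dist w y + r) powr p) * indicator B x"
        by (auto simp: q_def ennreal_leI)
    qed
    also have "\<dots> < \<infinity>" using B_pos by (simp add: nn_integral_cmult_indicator ennreal_mult_less_top)
    finally have "Dp_fun M p (q w) k < \<infinity>" by (simp add: Dp_fun_def ennreal_powr_def)
    moreover have "Dp M p (ae_class M (q w)) h = Dp_fun M p (q w) k"
      by (intro Dp_eq ae_class q_meas h k)
    ultimately show ?thesis using ae_class(1)[OF q_meas] by (simp add: Lp_def)
  qed
  let ?F = "ae_class M (q y)" and ?G = "ae_class M (q z)"
  define A where "A = Lp_dist M p ?F ?G"
  have A_nn: "0 \<le> A" by (simp add: A_def Lp_dist_def)
  have "Dp_fun M p (q y) (q z) = ennreal A"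
    unfolding A_def by (intro Lp_dist_reps[OF h p] q_Lp ae_class q_meas)
  moreover have "(\<integral>\<^sup>+x. ennreal (dist (q y x) (q z x) powr p) \<partial>M) = ennreal (dist y z powr p * \<mu>)"
  proof -
    have "(\<integral>\<^sup>+x. ennreal (dist (q y x) (q z x) powr p) \<partial>M) = (\<integral>\<^sup>+x. ennreal (dist y z powr p) * indicator B x \<partial>M)"
      using p by (intro nn_integral_cong) (auto simp: q_def indicator_def)
    then show ?thesis using \<mu> by (simp add: nn_integral_cmult_indicator ennreal_mult)
  qed
  ultimately have "ennreal ((dist y z powr p * \<mu>) powr (1 / p)) = ennreal A"
    using \<mu> by (simp add: Dp_fun_def ennreal_powr_def)
  then have "A = (dist y z powr p * \<mu>) powr (1 / p)" using A_nn by simp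
  then have A_p: "A powr p = dist y z powr p * \<mu>" using p \<mu> by (simp add: powr_powr)
  obtain K where K: "K \<in> Lp M p h" "Lp_dist M p ?F K \<le> \<kappa> / 2 * A" "Lp_dist M p K ?G \<le> \<kappa> / 2 * A"
    using mid q_Lp unfolding has_midpoints_def A_def by blast
  obtain m where m: "m \<in> K" using L0_rep K(1) by (auto simp: Lp_def)
  have [measurable]: "m \<in> borel_measurable M" using K(1) m L0_measurable by (auto simp: Lp_def)
  define c where "c = (\<kappa> / 2 * dist y z) powr p"
  have cA: "(\<kappa> / 2 * A) powr p = c * \<mu>"
  proof -
    have "(\<kappa> / 2 * A) powr p = (\<kappa> / 2) powr p * A powr p" by (rule powr_mult)
    moreover have "c = (\<kappa> / 2) powr p * dist y z powr p" unfolding c_def by (rule powr_mult)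
    ultimately show ?thesis by (simp only: A_p mult.assoc)
  qed
  have half: "(\<integral>\<^sup>+x. ennreal (dist (f x) (g x) powr p) \<partial>M) \<le> ennreal (c * \<mu>)"
    if "Dp_fun M p f g \<le> ennreal (\<kappa> / 2 * A)" for f g :: "'m \<Rightarrow> 'n"
    using that p \<kappa> A_nn unfolding Dp_fun_def cA[symmetric] by (subst (asm) ennreal_powr_le_iff) auto
  have 1: "(\<integral>\<^sup>+x. ennreal (dist (q y x) (m x) powr p) \<partial>M) \<le> ennreal (c * \<mu>)"
    using Lp_dist_reps[OF h p q_Lp K(1) ae_class(2)[OF q_meas] m] K(2) by (intro half) (simp add: ennreal_leI)
  have 2: "(\<integral>\<^sup>+x. ennreal (dist (m x) (q z x) powr p) \<partial>M) \<le> ennreal (c * \<mu>)"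
    using Lp_dist_reps[OF h p K(1) q_Lp m ae_class(2)[OF q_meas]] K(3) by (intro half) (simp add: ennreal_leI)
  have "(\<integral>\<^sup>+x\<in>B. ennreal (dist y (m x) powr p + dist (m x) z powr p) \<partial>M)
      \<le> (\<integral>\<^sup>+x. ennreal (dist (q y x) (m x) powr p) + ennreal (dist (m x) (q z x) powr p) \<partial>M)"
    by (intro nn_integral_mono) (auto simp: q_def indicator_def)
  also have "\<dots> = (\<integral>\<^sup>+x. ennreal (dist (q y x) (m x) powr p) \<partial>M) + (\<integral>\<^sup>+x. ennreal (dist (m x) (q z x) powr p) \<partial>M)"
    by (rule nn_integral_add) measurable
  also have "\<dots> \<le> ennreal (c * \<mu>) + ennreal (c * \<mu>)" using 1 2 by (rule add_mono)
  also have "\<dots> = ennreal (2 * c) * emeasure M B"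
    using \<mu> by (simp add: c_def ennreal_mult[symmetric] ennreal_plus[symmetric] del: ennreal_plus)
  finally have le: "(\<integral>\<^sup>+x\<in>B. ennreal (dist y (m x) powr p + dist (m x) z powr p) \<partial>M) \<le> ennreal (2 * c) * emeasure M B" .
  have c: "0 \<le> 2 * c" by (simp add: c_def)
  have "\<exists>x\<in>B. dist y (m x) powr p + dist (m x) z powr p \<le> 2 * c"
    by (rule exists_le_average[OF _ B B_pos c le]) measurable
  then obtain x where "dist y (m x) powr p + dist (m x) z powr p \<le> 2 * c" by blast
  then show thesis by (intro that[of "m x"]) (simp add: c_def)
qed

lemma midpoints_from_Lp_approximate:
  fixes h :: "('m \<Rightarrow> 'n::polish_space) set"
  assumes h: "h \<in> L0 M" and p: "1 < p" and M: "\<not> purely_infinite M"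
    and mid: "\<And>\<kappa>. 1 < \<kappa> \<Longrightarrow> has_midpoints \<kappa> (Lp M p h) (Lp_dist M p)" and \<kappa>: "1 < \<kappa>"
  shows "has_midpoints \<kappa> (UNIV :: 'n set) dist"
  unfolding has_midpoints_def
proof (intro ballI)
  fix y z :: 'n
  show "\<exists>w\<in>UNIV. dist y w \<le> \<kappa> / 2 * dist y z \<and> dist w z \<le> \<kappa> / 2 * dist y z"
  proof (cases "y = z")
    case False
    define a where "a = dist y z / 2"
    have a: "0 < a" using False by (simp add: a_def)
    obtain \<kappa>' where \<kappa>': "1 < \<kappa>'" and *: "\<And>u v. 0 \<le> u \<Longrightarrow> 0 \<le> v \<Longrightarrow> 2 * a \<le> u + v \<Longrightarrow>
        u powr p + v powr p \<le> 2 * (\<kappa>' * a) powr p \<Longrightarrow> u \<le> \<kappa> * a"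
      by (rule near_equality_forces_midpoint[OF p a \<kappa>]) (rule that)
    obtain w where w: "dist y w powr p + dist w z powr p \<le> 2 * (\<kappa>' / 2 * dist y z) powr p"
      by (rule Lp_midpoint_gives_near_midpoint[OF h p M _ mid[OF \<kappa>']]) (use \<kappa>' in auto)
    then have w: "dist y w powr p + dist w z powr p \<le> 2 * (\<kappa>' * a) powr p" by (simp add: a_def)
    have "2 * a \<le> dist y w + dist w z" using dist_triangle[of y z w] by (simp add: a_def)
    then have "dist y w \<le> \<kappa> * a" "dist w z \<le> \<kappa> * a"
      using *[of "dist y w" "dist w z"] *[of "dist w z" "dist y w"] w by (simp_all add: add.commute)
    then show ?thesis by (intro bexI[of _ w]) (simp_all add: a_def)
  qed auto
qed

lemma midpoints_from_Lp_exact: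
  fixes h :: "('m \<Rightarrow> 'n::polish_space) set"
  assumes h: "h \<in> L0 M" and p: "1 < p" and M: "\<not> purely_infinite M"
    and mid: "has_midpoints 1 (Lp M p h) (Lp_dist M p)"
  shows "has_midpoints 1 (UNIV :: 'n set) dist"
  unfolding has_midpoints_def
proof (intro ballI)
  fix y z :: 'n
  show "\<exists>w\<in>UNIV. dist y w \<le> 1 / 2 * dist y z \<and> dist w z \<le> 1 / 2 * dist y z"
  proof (cases "y = z")
    case False
    define a where "a = dist y z / 2"
    have a: "0 < a" using False by (simp add: a_def)
    obtain w where w: "dist y w powr p + dist w z powr p \<le> 2 * (1 / 2 * dist y z) powr p"
      by (rule Lp_midpoint_gives_near_midpoint[OF h p M _ mid]) auto
    then have w: "dist y w powr p + dist w z powr p \<le> 2 * a powr p" by (simp add: a_def)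
    have "2 * a \<le> dist y w + dist w z" using dist_triangle[of y z w] by (simp add: a_def)
    then have "dist y w \<le> a" "dist w z \<le> a"
      using equality_forces_midpoint[OF p a, of "dist y w" "dist w z"]
        equality_forces_midpoint[OF p a, of "dist w z" "dist y w"] w by (simp_all add: add.commute)
    then show ?thesis by (intro bexI[of _ w]) (simp_all add: a_def)
  qed auto
qed

text \<open>
  Each of the four implications runs from curves to midpoints in one space, then to midpoints or
  Lipschitz paths in the other, and back to curves there: with all factors \<open>\<kappa> > 1\<close> for length spaces and
  with \<open>\<kappa> = 1\<close> for geodesic spaces.
\<close>

theorem theorem4p9:
  fixes M :: "'m measure"
    and h :: "('m \<Rightarrow> 'n::polish_space) set"
    and p a b :: real
  assumes "space M \<noteq> {}"
    and "a < b"
    and "1 < p"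
    and "h \<in> L0 M"
    and "\<not> purely_infinite M"
  shows "(length_space a b (Lp M p h) (Lp_dist M p) \<longleftrightarrow> length_space a b (UNIV :: 'n set) dist)
    \<and> (geodesic_space a b (Lp M p h) (Lp_dist M p) \<longleftrightarrow> geodesic_space a b (UNIV :: 'n set) dist)"
proof -
  note ab = \<open>a < b\<close> and p = \<open>1 < p\<close> and h = \<open>h \<in> L0 M\<close> and M = \<open>\<not> purely_infinite M\<close>
  have X: "Metric_space (Lp M p h) (Lp_dist M p)" using p by (intro Metric_space_Lp h) simp
  have Y: "Metric_space (UNIV :: 'n set) dist" by (rule Met_TC.Metric_space_axioms)
  show ?thesis
  proof (intro conjI iffI)
    assume "length_space a b (Lp M p h) (Lp_dist M p)"
    then have "has_midpoints \<kappa> (UNIV :: 'n set) dist" if "1 < \<kappa>" for \<kappa>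
      using that by (intro midpoints_from_Lp_approximate[OF h p M] length_space_imp_midpoints[OF X ab])
    then have "has_Lipschitz_paths \<kappa> (UNIV :: 'n set) dist" if "1 < \<kappa>" for \<kappa>
      using that by (intro has_midpoints_imp_Lipschitz_paths) (simp_all add: refine_factor_gt_1)
    then show "length_space a b (UNIV :: 'n set) dist"
      by (rule Lipschitz_paths_imp_length_space[OF Y ab])
  next
    assume "length_space a b (UNIV :: 'n set) dist"
    then have "has_midpoints \<kappa> (UNIV :: 'n set) dist" if "1 < \<kappa>" for \<kappa>
      using that by (intro length_space_imp_midpoints[OF Y ab])
    then have "has_Lipschitz_paths \<kappa> (Lp M p h) (Lp_dist M p)" if "1 < \<kappa>" for \<kappa>
      using that by (intro Lp_has_Lipschitz_paths[OF h p]) (simp_all add: refine_factor_gt_1)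
    then show "length_space a b (Lp M p h) (Lp_dist M p)"
      by (rule Lipschitz_paths_imp_length_space[OF X ab])
  next
    assume "geodesic_space a b (Lp M p h) (Lp_dist M p)"
    then have "has_midpoints 1 (UNIV :: 'n set) dist"
      by (intro midpoints_from_Lp_exact[OF h p M] geodesic_space_imp_midpoints[OF X ab])
    then have "has_Lipschitz_paths 1 (UNIV :: 'n set) dist"
      by (intro has_midpoints_imp_Lipschitz_paths) simp_all
    then show "geodesic_space a b (UNIV :: 'n set) dist"
      by (rule Lipschitz_paths_imp_geodesic_space[OF Y ab])
  next
    assume "geodesic_space a b (UNIV :: 'n set) dist"
    then have "has_midpoints 1 (UNIV :: 'n set) dist"
      by (rule geodesic_space_imp_midpoints[OF Y ab])
    then have "has_Lipschitz_paths 1 (Lp M p h) (Lp_dist M p)"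
      by (intro Lp_has_Lipschitz_paths[OF h p]) simp_all
    then show "geodesic_space a b (Lp M p h) (Lp_dist M p)"
      by (rule Lipschitz_paths_imp_geodesic_space[OF X ab])
  qed
qed

end
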